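(* Let $\mathbb{H}$ be a complex separable Hilbert space, let $\{P_n\}$ be orthogonal projections on $\mathbb{H}$ with $\dim P_n(\mathbb{H})=n$ and $P_nx\to x$ for every $x\in\mathbb{H}$, and for each $n$ let $\tilde U_n$ be a unitary $n\times n$ matrix (acting on the range of $P_n$). For $A\in\mathbb{B}(\mathbb{H})$ put $A_n=P_nAP_n$ and $\Phi_n(A)=P_{\tilde U_n}(A_n)$, and let $\Phi$ be any limit point of the sequence $\{\Phi_n\}$ in Kadison's BW topology. Let $A\in\mathbb{B}(\mathbb{H})$ be self-adjoint and suppose that $P_{\tilde U_n}(A_n)$ converges to $A_n$ in strong cluster. Then $A-\Phi(A)$ is compact.
   Context: $A_n=P_nAP_n$ is regarded as an $n\times n$ matrix by restriction to the range of $P_n$ (with a fixed orthonormal basis); conversely an $n\times n$ matrix is regarded as an operator on $\mathbb{H}$ that vanishes on the orthogonal complement of the range of $P_n$. For a unitary $n\times n$ matrix $\tilde U_n$, let $M_{\tilde U_n}=\{X\in M_n(\mathbb{C}): \tilde U_n^*X\tilde U_n \text{ is diagonal}\}$. For $X\in M_n(\mathbb{C})$, $P_{\tilde U_n}(X)$ is the unique element of $M_{\tilde U_n}$ closest to $X$ in Frobenius norm; explicitly $P_{\tilde U_n}(X)=\tilde U_n\,\sigma(\tilde U_n^*X\tilde U_n)\,\tilde U_n^*$, where $\sigma(Y)$ is the diagonal matrix with the same diagonal entries as $Y$. Each $\Phi_n$ is a completely positive map on $\mathbb{B}(\mathbb{H})$ with $\Phi_n(I)\le I$. BW topology: a net $\Psi_\alpha$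 in the set of completely positive maps $\Psi$ on $\mathbb{B}(\mathbb{H})$ with $\Psi(I)\le I$ converges to $\Psi$ iff $\Psi_\alpha(T)\to\Psi(T)$ in the weak operator topology for every $T\in\mathbb{B}(\mathbb{H})$; this set is compact. A limit point of $\{\Phi_n\}$ is the limit of some convergent subnet of $\{\Phi_n\}$. Strong cluster: for sequences $\{X_n\},\{Y_n\}$ of Hermitian $n\times n$ matrices, $X_n$ converges to $Y_n$ in strong cluster if for every $\epsilon>0$ there exist integers $N_{1,\epsilon},N_{2,\epsilon}$ (independent of $n$) such that for all $n>N_{2,\epsilon}$ all singular values of $X_n-Y_n$ lie in $[0,\epsilon)$ except for at most $N_{1,\epsilon}$ of them (with multiplicity). *)

theory Defs
  imports
    "HOL-Analysis.Analysis"
    "HOL-Computational_Algebra.Computational_Algebra"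
    "Jordan_Normal_Form.Schur_Decomposition"
begin

section \<open>Complex Hilbert spaces\<close>

text \<open>
  The underlying real Hilbert space of a complex Hilbert space carries the inner product
  \<open>Re (cinner x y)\<close>, which induces the same norm; basing the class on \<^class>\<open>real_inner\<close> makes the
  normed-space library available. Positive definiteness of \<open>cinner\<close> comes from \<^class>\<open>real_inner\<close>.
  The form \<open>cinner\<close> is antilinear in its first argument.
\<close>

class chilbert_space = real_inner + complete_space +
  fixes scaleC :: "complex \<Rightarrow> 'a \<Rightarrow> 'a"  (infixr \<open>*\<^sub>C\<close> 75)
    and cinner :: "'a \<Rightarrow> 'a \<Rightarrow> complex"
  assumes scaleC_add_right: "c *\<^sub>C (x + y) = c *\<^sub>C x + c *\<^sub>C y"
    and scaleC_add_left: "(b + c) *\<^sub>C x = b *\<^sub>C x + c *\<^sub>C x"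
    and scaleC_scaleC: "b *\<^sub>C c *\<^sub>C x = (b * c) *\<^sub>C x"
    and scaleR_scaleC: "r *\<^sub>R x = complex_of_real r *\<^sub>C x"
    and cinner_commute: "cinner x y = cnj (cinner y x)"
    and cinner_add_right: "cinner x (y + z) = cinner x y + cinner x z"
    and cinner_scaleC_right: "cinner x (c *\<^sub>C y) = c * cinner x y"
    and inner_eq_Re_cinner: "inner x y = Re (cinner x y)"

lemma scaleC_one: "1 *\<^sub>C x = (x :: 'a::chilbert_space)"
  using scaleR_scaleC[of 1 x] by simp

global_interpretation complex_vector: vector_space "scaleC :: complex \<Rightarrow> 'a \<Rightarrow> 'a::chilbert_space"
  by unfold_locales (simp_all add: scaleC_add_right scaleC_add_left scaleC_scaleC scaleC_one)

lemma cinner_self: "cinner x x = complex_of_real ((norm x)\<^sup>2)" for x :: "'a::chilbert_space"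
proof -
  have "Im (cinner x x) = 0"
    using arg_cong[OF cinner_commute[of x x], of Im] by simp
  then show ?thesis
    by (simp add: complex_eq_iff power2_norm_eq_inner inner_eq_Re_cinner)
qed

lemma norm_scaleC: "norm (c *\<^sub>C x) = cmod c * norm x" for x :: "'a::chilbert_space"
proof -
  have "cinner (c *\<^sub>C x) (c *\<^sub>C x) = c * cnj c * cinner x x"
    by (metis (no_types, lifting) cinner_commute cinner_scaleC_right complex_cnj_mult mult.assoc)
  then have "complex_of_real ((norm (c *\<^sub>C x))\<^sup>2) = complex_of_real ((cmod c * norm x)\<^sup>2)"
    by (simp only: cinner_self complex_norm_square[symmetric] power_mult_distrib of_real_mult)
  then have "(norm (c *\<^sub>C x))\<^sup>2 = (cmod c * norm x)\<^sup>2"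
    by (simp only: of_real_eq_iff)
  then show ?thesis by (simp add: power2_eq_iff_nonneg)
qed

lemma bounded_linear_scaleC: "bounded_linear (\<lambda>x. c *\<^sub>C x :: 'a::chilbert_space)"
  by (rule bounded_linear_intro[where K="cmod c"])
    (simp_all add: scaleC_add_right scaleR_scaleC scaleC_scaleC mult.commute norm_scaleC)

lemma cinner_cauchy_schwarz: "cmod (cinner x y) \<le> norm x * norm y" for x y :: "'a::chilbert_space"
proof -
  define c where "c = (if cinner x y = 0 then 1 else cnj (cinner x y) / cmod (cinner x y))"
  have c: "cmod c = 1" by (auto simp: c_def norm_divide)
  have "c * cinner x y = cmod (cinner x y)"
    by (auto simp: c_def complex_norm_square[symmetric] power2_eq_square mult.commute)
  then have "cmod (cinner x y) = inner x (c *\<^sub>C y)"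
    by (simp add: inner_eq_Re_cinner cinner_scaleC_right)
  also have "\<dots> \<le> norm x * norm (c *\<^sub>C y)" by (rule norm_cauchy_schwarz)
  finally show ?thesis by (simp add: norm_scaleC c)
qed

lemma bounded_linear_cinner_right: "bounded_linear (cinner (x :: 'a::chilbert_space))"
  by (rule bounded_linear_intro[where K="norm x"])
    (simp_all add: cinner_add_right scaleR_scaleC cinner_scaleC_right scaleR_conv_of_real
      cinner_cauchy_schwarz mult.commute[of "norm _" "norm x"])

section \<open>Bounded complex-linear operators\<close>

text \<open>
  \<^typ>\<open>'a \<Rightarrow>\<^sub>L 'a\<close> consists of the bounded real-linear operators; the algebra of bounded operators on
  the complex Hilbert space is the following subset.
\<close>

definition bounded_operators :: "('a::chilbert_space \<Rightarrow>\<^sub>L 'a) set" where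
  "bounded_operators = {T :: 'a \<Rightarrow>\<^sub>L 'a. \<forall>c x. T (c *\<^sub>C x) = c *\<^sub>C T x}"

lift_definition scaleC_op :: "complex \<Rightarrow> ('a::chilbert_space \<Rightarrow>\<^sub>L 'a) \<Rightarrow> 'a \<Rightarrow>\<^sub>L 'a"
  is "\<lambda>c T x. c *\<^sub>C T x"
  by (rule bounded_linear_compose[OF bounded_linear_scaleC])

definition self_adjoint :: "('a::chilbert_space \<Rightarrow>\<^sub>L 'a) \<Rightarrow> bool" where
  "self_adjoint T \<longleftrightarrow> (\<forall>x y. cinner (T x) y = cinner x (T y))"

definition orthogonal_projection :: "('a::chilbert_space \<Rightarrow>\<^sub>L 'a) \<Rightarrow> bool" where
  "orthogonal_projection P \<longleftrightarrow> P \<in> bounded_operators \<and> P o\<^sub>L P = P \<and> self_adjoint P"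

definition compact_operator :: "('a::chilbert_space \<Rightarrow>\<^sub>L 'a) \<Rightarrow> bool" where
  "compact_operator T \<longleftrightarrow> T \<in> bounded_operators \<and> compact (closure (blinfun_apply T ` cball 0 1))"

text \<open>
  \<open>(M i j)\<close>, \<open>i, j < k\<close>, is a \<open>k \<times> k\<close> matrix of operators, acting on the \<open>k\<close>-fold direct sum.
\<close>

definition positive_op_matrix :: "nat \<Rightarrow> (nat \<Rightarrow> nat \<Rightarrow> 'a::chilbert_space \<Rightarrow>\<^sub>L 'a) \<Rightarrow> bool" where
  "positive_op_matrix k M \<longleftrightarrow>
     (\<forall>v. (\<Sum>i<k. \<Sum>j<k. cinner (v i) (M i j (v j))) \<in> \<real>\<^sub>\<ge>\<^sub>0)"

definition positive_op :: "('a::chilbert_space \<Rightarrow>\<^sub>L 'a) \<Rightarrow> bool" where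
  "positive_op T \<longleftrightarrow> (\<forall>x. cinner x (T x) \<in> \<real>\<^sub>\<ge>\<^sub>0)"

section \<open>Completely positive maps and the BW topology\<close>

text \<open>
  Maps on the algebra of bounded operators are represented by functions on \<^typ>\<open>'a \<Rightarrow>\<^sub>L 'a\<close>; only
  their values on \<^const>\<open>bounded_operators\<close> matter.
\<close>

definition completely_positive ::
    "(('a::chilbert_space \<Rightarrow>\<^sub>L 'a) \<Rightarrow> ('a \<Rightarrow>\<^sub>L 'a)) \<Rightarrow> bool" where
  "completely_positive \<Psi> \<longleftrightarrow>
     (\<forall>T\<in>bounded_operators. \<Psi> T \<in> bounded_operators) \<and>
     (\<forall>S\<in>bounded_operators. \<forall>T\<in>bounded_operators. \<Psi> (S + T) = \<Psi> S + \<Psi> T) \<and>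
     (\<forall>c. \<forall>T\<in>bounded_operators. \<Psi> (scaleC_op c T) = scaleC_op c (\<Psi> T)) \<and>
     (\<forall>k M. (\<forall>i<k. \<forall>j<k. M i j \<in> bounded_operators) \<longrightarrow> positive_op_matrix k M \<longrightarrow>
        positive_op_matrix k (\<lambda>i j. \<Psi> (M i j)))"

definition cp_contractions :: "(('a::chilbert_space \<Rightarrow>\<^sub>L 'a) \<Rightarrow> ('a \<Rightarrow>\<^sub>L 'a)) set" where
  "cp_contractions = {\<Psi>. completely_positive \<Psi> \<and> positive_op (id_blinfun - \<Psi> id_blinfun)}"

definition wot_tendsto ::
    "('i \<Rightarrow> 'a::chilbert_space \<Rightarrow>\<^sub>L 'a) \<Rightarrow> ('a \<Rightarrow>\<^sub>L 'a) \<Rightarrow> 'i filter \<Rightarrow> bool" where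
  "wot_tendsto S T F \<longleftrightarrow> (\<forall>x y. ((\<lambda>i. cinner x (S i y)) \<longlongrightarrow> cinner x (T y)) F)"

definition bw_tendsto ::
    "('i \<Rightarrow> ('a::chilbert_space \<Rightarrow>\<^sub>L 'a) \<Rightarrow> ('a \<Rightarrow>\<^sub>L 'a)) \<Rightarrow>
     (('a \<Rightarrow>\<^sub>L 'a) \<Rightarrow> ('a \<Rightarrow>\<^sub>L 'a)) \<Rightarrow> 'i filter \<Rightarrow> bool" where
  "bw_tendsto \<Psi> \<Theta> F \<longleftrightarrow>
     (\<forall>\<^sub>F i in F. \<Psi> i \<in> cp_contractions) \<and> \<Theta> \<in> cp_contractions \<and>
     (\<forall>T\<in>bounded_operators. wot_tendsto (\<lambda>i. \<Psi> i T) (\<Theta> T) F)"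

definition directed_set :: "'i set \<Rightarrow> ('i \<Rightarrow> 'i \<Rightarrow> bool) \<Rightarrow> bool" where
  "directed_set D R \<longleftrightarrow> D \<noteq> {} \<and>
     (\<forall>i\<in>D. R i i) \<and>
     (\<forall>i\<in>D. \<forall>j\<in>D. \<forall>k\<in>D. R i j \<longrightarrow> R j k \<longrightarrow> R i k) \<and>
     (\<forall>i\<in>D. \<forall>j\<in>D. \<exists>k\<in>D. R i k \<and> R j k)"

definition net_filter :: "'i set \<Rightarrow> ('i \<Rightarrow> 'i \<Rightarrow> bool) \<Rightarrow> 'i filter" where
  "net_filter D R = (INF d\<in>D. principal {e \<in> D. R d e})"

lemma eventually_net_filter:
  assumes "directed_set D R"
  shows "eventually Q (net_filter D R) \<longleftrightarrow> (\<exists>d\<in>D. \<forall>e\<in>D. R d e \<longrightarrow> Q e)"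
  unfolding net_filter_def
proof (subst eventually_INF_base)
  show "D \<noteq> {}" using assms by (simp add: directed_set_def)
next
  fix a b assume ab: "a \<in> D" "b \<in> D"
  then obtain c where c: "c \<in> D" "R a c" "R b c"
    using assms unfolding directed_set_def by meson
  have "R a e \<and> R b e" if "e \<in> D" "R c e" for e
    using assms ab c that unfolding directed_set_def by blast
  then show "\<exists>x\<in>D. principal {e \<in> D. R x e} \<le> inf (principal {e \<in> D. R a e}) (principal {e \<in> D. R b e})"
    using c(1) by (intro bexI[of _ c]) auto
qed (auto simp: eventually_principal)

text \<open>
  \<open>\<Theta>\<close> is the limit of the subnet \<open>d \<mapsto> \<Psi> (h d)\<close>, \<open>d \<in> D\<close>, of the sequence \<open>\<Psi>\<close>. (Subnets in the
  sense of Kelley: \<open>h\<close> is eventually beyond every \<open>N\<close>, but need not be monotone.) A limit point of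
  \<open>\<Psi>\<close> is a \<open>\<Theta>\<close> for which there are an index type and such \<open>D\<close>, \<open>R\<close>, \<open>h\<close>.
\<close>

definition bw_subnet_limit ::
    "'i set \<Rightarrow> ('i \<Rightarrow> 'i \<Rightarrow> bool) \<Rightarrow> ('i \<Rightarrow> nat) \<Rightarrow>
     (nat \<Rightarrow> ('a::chilbert_space \<Rightarrow>\<^sub>L 'a) \<Rightarrow> ('a \<Rightarrow>\<^sub>L 'a)) \<Rightarrow>
     (('a \<Rightarrow>\<^sub>L 'a) \<Rightarrow> ('a \<Rightarrow>\<^sub>L 'a)) \<Rightarrow> bool" where
  "bw_subnet_limit D R h \<Psi> \<Theta> \<longleftrightarrow>
     directed_set D R \<and> filterlim h sequentially (net_filter D R) \<and>
     bw_tendsto (\<lambda>d. \<Psi> (h d)) \<Theta> (net_filter D R)"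

section \<open>Matrices\<close>

lemma mat_adjoint_dim [simp]:
  "dim_row (mat_adjoint A) = dim_col A" "dim_col (mat_adjoint A) = dim_row A"
  by (simp_all add: mat_adjoint_def)

lemma mat_adjoint_carrier [simp]: "A \<in> carrier_mat n m \<Longrightarrow> mat_adjoint A \<in> carrier_mat m n"
  by (intro carrier_matI) auto

lemma mat_adjoint_index:
  "i < dim_col A \<Longrightarrow> j < dim_row A \<Longrightarrow> mat_adjoint A $$ (i, j) = cnj (A $$ (j, i))"
  by (simp add: mat_adjoint_def mat_of_rows_def)

definition unitary_matrix :: "nat \<Rightarrow> complex mat \<Rightarrow> bool" where
  "unitary_matrix n U \<longleftrightarrow>
     U \<in> carrier_mat n n \<and> mat_adjoint U * U = 1\<^sub>m n \<and> U * mat_adjoint U = 1\<^sub>m n"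

definition frobenius_norm :: "complex mat \<Rightarrow> real" where
  "frobenius_norm X = sqrt (\<Sum>i<dim_row X. \<Sum>j<dim_col X. (cmod (X $$ (i, j)))\<^sup>2)"

definition diagonalized_by :: "nat \<Rightarrow> complex mat \<Rightarrow> complex mat set" where
  "diagonalized_by n U = {X \<in> carrier_mat n n. diagonal_mat (mat_adjoint U * X * U)}"

definition nearest_diagonalized :: "nat \<Rightarrow> complex mat \<Rightarrow> complex mat \<Rightarrow> complex mat" where
  "nearest_diagonalized n U X = (THE Y. Y \<in> diagonalized_by n U \<and>
     (\<forall>Z\<in>diagonalized_by n U. frobenius_norm (X - Y) \<le> frobenius_norm (X - Z)))"

definition singular_values :: "complex mat \<Rightarrow> real multiset" where
  "singular_values X = image_mset (\<lambda>z. sqrt (Re z)) (proots (char_poly (mat_adjoint X * X)))"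

text \<open>Intended for sequences of Hermitian matrices, the \<open>n\<close>-th ones of size \<open>n \<times> n\<close>.\<close>

definition converges_in_strong_cluster ::
    "(nat \<Rightarrow> complex mat) \<Rightarrow> (nat \<Rightarrow> complex mat) \<Rightarrow> bool" where
  "converges_in_strong_cluster X Y \<longleftrightarrow>
     (\<forall>\<epsilon>>0. \<exists>N1 N2. \<forall>n>N2. size {#s \<in># singular_values (X n - Y n). s \<notin> {0..<\<epsilon>}#} \<le> N1)"

subsection \<open>The explicit form of the nearest matrix\<close>

definition diagonal_part :: "complex mat \<Rightarrow> complex mat" where
  "diagonal_part Y =
     mat (dim_row Y) (dim_col Y) (\<lambda>(i, j). if i = j then Y $$ (i, j) else 0)"

lemma frobenius_norm_sq:
  "(frobenius_norm X)\<^sup>2 = (\<Sum>i<dim_row X. \<Sum>j<dim_col X. (cmod (X $$ (i, j)))\<^sup>2)"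
  by (simp add: frobenius_norm_def sum_nonneg)

lemma frobenius_norm_nonneg: "0 \<le> frobenius_norm X"
  by (simp add: frobenius_norm_def sum_nonneg)

lemma frobenius_norm_adjoint: "frobenius_norm (mat_adjoint X) = frobenius_norm X"
  unfolding frobenius_norm_def by (subst sum.swap) (simp add: mat_adjoint_index)

lemma frobenius_norm_gram:
  "complex_of_real ((frobenius_norm X)\<^sup>2) = (\<Sum>j<dim_col X. (mat_adjoint X * X) $$ (j, j))"
proof -
  have "(mat_adjoint X * X) $$ (j, j) = (\<Sum>i<dim_row X. complex_of_real ((cmod (X $$ (i, j)))\<^sup>2))"
    if "j < dim_col X" for j
  proof -
    have "(mat_adjoint X * X) $$ (j, j) = (\<Sum>i<dim_row X. cnj (X $$ (i, j)) * X $$ (i, j))"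
      using that by (simp add: scalar_prod_def mat_adjoint_index lessThan_atLeast0)
    also have "\<dots> = (\<Sum>i<dim_row X. complex_of_real ((cmod (X $$ (i, j)))\<^sup>2))"
      by (intro sum.cong refl) (simp add: complex_norm_square mult.commute del: of_real_power)
    finally show ?thesis .
  qed
  then show ?thesis
    unfolding frobenius_norm_sq by (subst sum.swap) simp
qed

lemma mat_adjoint_mult:
  fixes A B :: "complex mat"
  assumes "A \<in> carrier_mat n m" "B \<in> carrier_mat m k"
  shows "mat_adjoint (A * B) = mat_adjoint B * mat_adjoint A"
proof (rule eq_matI)
  fix i j assume "i < dim_row (mat_adjoint B * mat_adjoint A)"
    "j < dim_col (mat_adjoint B * mat_adjoint A)"
  then have ij: "i < k" "j < n" using assms by auto
  show "mat_adjoint (A * B) $$ (i, j) = (mat_adjoint B * mat_adjoint A) $$ (i, j)"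
    using ij carrier_matD[OF assms(1)] carrier_matD[OF assms(2)]
    by (simp add: mat_adjoint_index scalar_prod_def mult.commute)
qed (use assms in auto)

lemma mat_adjoint_adjoint: "mat_adjoint (mat_adjoint A) = (A :: complex mat)"
  by (rule eq_matI) (simp_all add: mat_adjoint_index)

lemma frobenius_norm_unitary_left:
  assumes U: "U \<in> carrier_mat n n" "mat_adjoint U * U = 1\<^sub>m n" and X: "X \<in> carrier_mat n m"
  shows "frobenius_norm (U * X) = frobenius_norm X"
proof -
  have a: "mat_adjoint U \<in> carrier_mat n n" "mat_adjoint X \<in> carrier_mat m n"
    using U(1) X by simp_all
  have "mat_adjoint (U * X) * (U * X) = mat_adjoint X * (mat_adjoint U * (U * X))"
    unfolding mat_adjoint_mult[OF U(1) X]
    by (rule assoc_mult_mat[OF a(2,1)]) (use U(1) X in auto)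
  also have "mat_adjoint U * (U * X) = mat_adjoint U * U * X"
    by (rule assoc_mult_mat[OF a(1) U(1) X, symmetric])
  also have "mat_adjoint X * (mat_adjoint U * U * X) = mat_adjoint X * (mat_adjoint U * U) * X"
    by (rule assoc_mult_mat[symmetric, OF a(2) _ X]) (use U(1) a(1) in auto)
  also have "\<dots> = mat_adjoint X * X" using X by (simp add: U(2))
  finally have "complex_of_real ((frobenius_norm (U * X))\<^sup>2) = complex_of_real ((frobenius_norm X)\<^sup>2)"
    using U(1) X by (simp only: frobenius_norm_gram) simp
  then have "(frobenius_norm (U * X))\<^sup>2 = (frobenius_norm X)\<^sup>2" by (simp only: of_real_eq_iff)
  then show ?thesis by (simp add: power2_eq_iff_nonneg frobenius_norm_nonneg)
qed

lemma frobenius_norm_unitary_conj: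
  assumes U: "unitary_matrix n U" and X: "X \<in> carrier_mat n n"
  shows "frobenius_norm (mat_adjoint U * X * U) = frobenius_norm X"
proof -
  have Uc: "U \<in> carrier_mat n n" "mat_adjoint U \<in> carrier_mat n n"
    and U1: "mat_adjoint U * U = 1\<^sub>m n" "mat_adjoint (mat_adjoint U) * mat_adjoint U = 1\<^sub>m n"
    using U by (auto simp: unitary_matrix_def mat_adjoint_adjoint)
  have "frobenius_norm (mat_adjoint U * X * U) = frobenius_norm (mat_adjoint U * (X * U))"
    using Uc X by (simp add: assoc_mult_mat[of _ n n _ n _ n])
  also have "\<dots> = frobenius_norm (X * U)"
    using frobenius_norm_unitary_left[OF Uc(2) U1(2)] Uc X by (metis mult_carrier_mat)
  also have "\<dots> = frobenius_norm (mat_adjoint U * mat_adjoint X)"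
    using mat_adjoint_mult[OF X Uc(1)] frobenius_norm_adjoint by metis
  also have "\<dots> = frobenius_norm X"
    using frobenius_norm_unitary_left[OF Uc(2) U1(2)] X frobenius_norm_adjoint by (metis mat_adjoint_carrier)
  finally show ?thesis .
qed

lemma frobenius_norm_diagonal_part:
  assumes Y: "Y \<in> carrier_mat n n" and E: "E \<in> carrier_mat n n" "diagonal_mat E"
  shows "(frobenius_norm (Y - E))\<^sup>2 =
    (frobenius_norm (Y - diagonal_part Y))\<^sup>2 + (frobenius_norm (diagonal_part Y - E))\<^sup>2"
proof -
  define S where "S = diagonal_part Y"
  have d: "dim_row Y = n" "dim_col Y = n" "dim_row E = n" "dim_col E = n" "dim_row S = n" "dim_col S = n"
    using Y E(1) by (auto simp: S_def diagonal_part_def)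
  have S: "S $$ (i, j) = (if i = j then Y $$ (i, j) else 0)" if "i < n" "j < n" for i j
    using that d by (simp add: S_def diagonal_part_def)
  have E0: "E $$ (i, j) = 0" if "i < n" "j < n" "i \<noteq> j" for i j
    using that d E(2) by (simp add: diagonal_mat_def)
  have "(cmod ((Y - E) $$ (i, j)))\<^sup>2 = (cmod ((Y - S) $$ (i, j)))\<^sup>2 + (cmod ((S - E) $$ (i, j)))\<^sup>2"
    if "i < n" "j < n" for i j
    by (cases "i = j") (use that d S E0 in simp_all)
  then show ?thesis
    unfolding S_def[symmetric] frobenius_norm_sq sum.distrib[symmetric] index_minus_mat(2,3) d
    by (intro sum.cong refl) simp
qed

lemma frobenius_norm_eq_0:
  assumes X: "X \<in> carrier_mat n m" and Y: "Y \<in> carrier_mat n m" and 0: "frobenius_norm (X - Y) = 0"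
  shows "X = Y"
proof (rule eq_matI)
  fix i j assume "i < dim_row Y" "j < dim_col Y"
  then have ij: "i < n" "j < m" using Y by auto
  have "(cmod ((X - Y) $$ (i, j)))\<^sup>2 \<le> (\<Sum>j<m. (cmod ((X - Y) $$ (i, j)))\<^sup>2)"
    by (rule member_le_sum) (use ij in auto)
  also have "\<dots> \<le> (\<Sum>i<n. \<Sum>j<m. (cmod ((X - Y) $$ (i, j)))\<^sup>2)"
    by (rule member_le_sum[of i "{..<n}" "\<lambda>i. \<Sum>j<m. (cmod ((X - Y) $$ (i, j)))\<^sup>2"])
      (use ij in \<open>auto intro: sum_nonneg\<close>)
  also have "\<dots> = (frobenius_norm (X - Y))\<^sup>2"
    using carrier_matD[OF Y] by (simp only: frobenius_norm_sq index_minus_mat(2,3))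
  finally have "(X - Y) $$ (i, j) = 0" by (simp add: 0)
  then show "X $$ (i, j) = Y $$ (i, j)" using ij carrier_matD[OF Y] by simp
qed (use X Y in auto)

theorem nearest_diagonalized_eq:
  assumes U: "unitary_matrix n U" and X: "X \<in> carrier_mat n n"
  shows "nearest_diagonalized n U X = U * diagonal_part (mat_adjoint U * X * U) * mat_adjoint U"
proof -
  let ?c = "\<lambda>Z. mat_adjoint U * Z * U"
  define Y where "Y = U * diagonal_part (?c X) * mat_adjoint U"
  have Uc: "U \<in> carrier_mat n n" "mat_adjoint U \<in> carrier_mat n n"
    and U1: "mat_adjoint U * U = 1\<^sub>m n" "U * mat_adjoint U = 1\<^sub>m n"
    using U by (auto simp: unitary_matrix_def)
  have dc: "diagonal_part (?c X) \<in> carrier_mat n n"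
    using Uc X by (auto simp: diagonal_part_def)
  have Yc: "Y \<in> carrier_mat n n" unfolding Y_def using Uc dc by (meson mult_carrier_mat)
  note assoc = assoc_mult_mat[of _ n n _ n _ n]
  have cY: "?c Y = diagonal_part (?c X)"
  proof -
    define S where "S = diagonal_part (?c X)"
    have S: "S \<in> carrier_mat n n" using dc by (simp add: S_def)
    have US: "U * S \<in> carrier_mat n n" using Uc(1) S by (rule mult_carrier_mat)
    have "?c Y = mat_adjoint U * (U * S) * mat_adjoint U * U"
      unfolding Y_def S_def[symmetric] by (simp only: assoc[OF Uc(2) US Uc(2)])
    also have "mat_adjoint U * (U * S) = S"
      using S by (simp only: assoc[OF Uc(2,1) S, symmetric] U1 left_mult_one_mat)
    also have "S * mat_adjoint U * U = S"
      using S by (simp only: assoc[OF S Uc(2,1)] U1 right_mult_one_mat)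
    finally show ?thesis by (simp only: S_def)
  qed
  have cc: "?c Z \<in> carrier_mat n n" if "Z \<in> carrier_mat n n" for Z
    using Uc that by auto
  have cdiff: "?c (Z - W) = ?c Z - ?c W" if "Z \<in> carrier_mat n n" "W \<in> carrier_mat n n" for Z W
    unfolding mult_minus_distrib_mat[OF Uc(2) that]
    by (rule minus_mult_distrib_mat[OF mult_carrier_mat[OF Uc(2) that(1)] mult_carrier_mat[OF Uc(2) that(2)] Uc(1)])
  have fc: "frobenius_norm (Z - W) = frobenius_norm (?c Z - ?c W)"
    if "Z \<in> carrier_mat n n" "W \<in> carrier_mat n n" for Z W
    using frobenius_norm_unitary_conj[OF U minus_carrier_mat[OF that(2)], of Z] cdiff[OF that] by simp
  have pyth: "(frobenius_norm (X - Z))\<^sup>2 = (frobenius_norm (X - Y))\<^sup>2 + (frobenius_norm (Y - Z))\<^sup>2"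
    if "Z \<in> diagonalized_by n U" for Z
  proof -
    have Z: "Z \<in> carrier_mat n n" "diagonal_mat (?c Z)" using that by (auto simp: diagonalized_by_def)
    show ?thesis
      using frobenius_norm_diagonal_part[OF cc[OF X] cc[OF Z(1)] Z(2)]
      by (simp add: fc[OF X Z(1)] fc[OF X Yc] fc[OF Yc Z(1)] cY)
  qed
  have Ym: "Y \<in> diagonalized_by n U"
    using Yc by (auto simp: diagonalized_by_def cY) (auto simp: diagonal_mat_def diagonal_part_def)
  have "nearest_diagonalized n U X = Y"
    unfolding nearest_diagonalized_def
  proof (rule the_equality, intro conjI ballI)
    fix Z assume "Z \<in> diagonalized_by n U"
    then have "(frobenius_norm (X - Y))\<^sup>2 \<le> (frobenius_norm (X - Z))\<^sup>2"
      by (subst pyth[of Z]) auto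
    then show "frobenius_norm (X - Y) \<le> frobenius_norm (X - Z)"
      by (rule power2_le_imp_le) (rule frobenius_norm_nonneg)
  next
    fix Z assume Z: "Z \<in> diagonalized_by n U \<and>
      (\<forall>W\<in>diagonalized_by n U. frobenius_norm (X - Z) \<le> frobenius_norm (X - W))"
    then have "(frobenius_norm (X - Z))\<^sup>2 \<le> (frobenius_norm (X - Y))\<^sup>2"
      using Ym by (intro power_mono) (auto simp: frobenius_norm_nonneg)
    then have "frobenius_norm (Y - Z) = 0" using pyth[of Z] Z by auto
    then show "Z = Y"
      using frobenius_norm_eq_0[OF Yc, of Z] Z by (auto simp: diagonalized_by_def)
  qed (rule Ym)
  then show ?thesis by (simp add: Y_def)
qed

section \<open>Compressions\<close>

text \<open>
  \<open>e 0, \<dots>, e (n - 1)\<close> is an orthonormal basis of the (finite-dimensional) complex subspace \<open>V\<close>.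
\<close>

definition orthonormal_basis_of :: "(nat \<Rightarrow> 'a::chilbert_space) \<Rightarrow> nat \<Rightarrow> 'a set \<Rightarrow> bool" where
  "orthonormal_basis_of e n V \<longleftrightarrow>
     (\<forall>i<n. \<forall>j<n. cinner (e i) (e j) = (if i = j then 1 else 0)) \<and>
     complex_vector.span (e ` {..<n}) = V"

definition matrix_of_op ::
    "(nat \<Rightarrow> 'a::chilbert_space) \<Rightarrow> nat \<Rightarrow> ('a \<Rightarrow>\<^sub>L 'a) \<Rightarrow> complex mat" where
  "matrix_of_op e n T = mat n n (\<lambda>(i, j). cinner (e i) (T (e j)))"

text \<open>The operator with matrix \<open>X\<close> on the span of \<open>e 0, \<dots>, e (n - 1)\<close>, and \<open>0\<close> on its complement.\<close>

lift_definition op_of_matrix ::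
    "(nat \<Rightarrow> 'a::chilbert_space) \<Rightarrow> nat \<Rightarrow> complex mat \<Rightarrow> 'a \<Rightarrow>\<^sub>L 'a"
  is "\<lambda>e n X v. \<Sum>i<n. \<Sum>j<n. (X $$ (i, j) * cinner (e j) v) *\<^sub>C e i"
proof (intro bounded_linear_sum)
  fix e :: "nat \<Rightarrow> 'a" and X :: "complex mat" and i j :: nat
  show "bounded_linear (\<lambda>v. (X $$ (i, j) * cinner (e j) v) *\<^sub>C e i)"
  proof (rule bounded_linear_intro[where K="cmod (X $$ (i, j)) * norm (e j) * norm (e i)"])
    fix v
    have "cmod (X $$ (i, j)) * cmod (cinner (e j) v) * norm (e i)
        \<le> cmod (X $$ (i, j)) * (norm (e j) * norm v) * norm (e i)"
      by (intro mult_right_mono mult_left_mono cinner_cauchy_schwarz) auto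
    then show "norm ((X $$ (i, j) * cinner (e j) v) *\<^sub>C e i)
        \<le> norm v * (cmod (X $$ (i, j)) * norm (e j) * norm (e i))"
      by (simp add: norm_scaleC norm_mult mult_ac)
  qed (simp_all add: cinner_add_right scaleR_scaleC cinner_scaleC_right scaleC_scaleC
      distrib_left scaleC_add_left mult_ac)
qed

text \<open>The matrix of \<open>P\<^sub>n A P\<^sub>n\<close> with respect to the basis \<open>e n\<close> of the range of \<open>P\<^sub>n\<close>.\<close>

definition compression ::
    "(nat \<Rightarrow> 'a::chilbert_space \<Rightarrow>\<^sub>L 'a) \<Rightarrow> (nat \<Rightarrow> nat \<Rightarrow> 'a) \<Rightarrow> nat \<Rightarrow> ('a \<Rightarrow>\<^sub>L 'a) \<Rightarrow> complex mat"
  where "compression P e n A = matrix_of_op (e n) n (P n o\<^sub>L A o\<^sub>L P n)"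

definition preconditioner_map ::
    "(nat \<Rightarrow> 'a::chilbert_space \<Rightarrow>\<^sub>L 'a) \<Rightarrow> (nat \<Rightarrow> nat \<Rightarrow> 'a) \<Rightarrow> (nat \<Rightarrow> complex mat) \<Rightarrow>
     nat \<Rightarrow> ('a \<Rightarrow>\<^sub>L 'a) \<Rightarrow> ('a \<Rightarrow>\<^sub>L 'a)" where
  "preconditioner_map P e U n A =
     op_of_matrix (e n) n (nearest_diagonalized n (U n) (compression P e n A))"

end

theory Submission
  imports Defs
begin

text \<open>
  Write \<open>S\<^sub>n = P\<^sub>n A P\<^sub>n - \<Phi>\<^sub>n(A)\<close> and \<open>T = A - \<Phi>(A)\<close>. Along the given subnet \<open>S\<^sub>n\<close> tends to \<open>T\<close> in the
  weak operator topology, since \<open>P\<^sub>n A P\<^sub>n\<close> tends to \<open>A\<close>. Strong clustering says that, for each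
  \<open>\<epsilon> > 0\<close>, all but \<open>N(\<epsilon>)\<close> singular values of \<open>S\<^sub>n\<close> are below \<open>\<epsilon>\<close>; by the spectral theorem for
  \<open>S\<^sub>n\<^sup>* S\<^sub>n\<close> this means that \<open>norm (S\<^sub>n x) \<le> \<epsilon> * norm x\<close> whenever \<open>x\<close> is orthogonal to certain at
  most \<open>N(\<epsilon>)\<close> vectors, which depend on \<open>n\<close> while \<open>N(\<epsilon>)\<close> does not
  (\<open>quadratic_bound_off_large_singular_values\<close>, \<open>small_on_codim_op_of_matrix\<close>).

  These exceptional vectors need not converge, so \<open>T\<close> is examined indirectly. If \<open>T\<close> is not
  compact, then for some \<open>\<delta> > 0\<close> no finite set of orthogonality conditions forces
  \<open>norm (T x) \<le> \<delta> * norm x\<close> (\<open>compact_operatorI\<close>). As \<open>T\<close> is self-adjoint, one can choose,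
  one after another, arbitrarily many orthonormal vectors \<open>v\<^sub>i\<close> whose images are pairwise orthogonal
  of norm at least \<open>\<delta>\<close> (\<open>orthonormal_system_with_orthogonal_images\<close>): both requirements on a new
  vector are orthogonality conditions, to the \<open>v\<^sub>i\<close> and to the \<open>T (T v\<^sub>i)\<close>. With
  \<open>y\<^sub>i = T v\<^sub>i / norm (T v\<^sub>i)\<close> the matrix of the numbers \<open>cinner y\<^sub>i (T v\<^sub>j)\<close> is diagonal with entries
  at least \<open>\<delta>\<close>, and the corresponding matrices of \<open>S\<^sub>n\<close> converge to it, only finitely many entries
  being involved. But out of \<open>N(\<delta>/2) + 1\<close> vectors \<open>v\<^sub>i\<close> a unit vector can be combined that is
  orthogonal to the exceptional vectors of \<open>S\<^sub>n\<close>, and on it \<open>S\<^sub>n\<close> is bounded by \<open>\<delta>/2\<close>. This is the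
  contradiction (\<open>wot_limit_lower_bound\<close>, \<open>compact_operator_wot_limit\<close>).

  Self-adjointness of \<open>\<Phi>(A)\<close> comes from positivity of \<open>\<Phi>\<close>
  (\<open>completely_positive_self_adjoint\<close>).
\<close>

section \<open>Orthonormal systems in complex Hilbert spaces\<close>

lemma cinner_add_left: "cinner (x + y) z = cinner x z + cinner y (z :: 'a::chilbert_space)"
  by (metis cinner_add_right cinner_commute complex_cnj_add)

lemma cinner_scaleC_left: "cinner (c *\<^sub>C x) y = cnj c * cinner x (y :: 'a::chilbert_space)"
  by (metis cinner_commute cinner_scaleC_right complex_cnj_mult)

lemma cinner_zero_right [simp]: "cinner x (0 :: 'a::chilbert_space) = 0"
  by (rule linear_0[OF bounded_linear.linear[OF bounded_linear_cinner_right]])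

lemma cinner_diff_right: "cinner x (y - z) = cinner x y - cinner x (z :: 'a::chilbert_space)"
  by (rule linear_diff[OF bounded_linear.linear[OF bounded_linear_cinner_right]])

lemma cinner_sum_right: "cinner x (\<Sum>i\<in>I. f i) = (\<Sum>i\<in>I. cinner x (f i :: 'a::chilbert_space))"
  by (rule linear_sum[OF bounded_linear.linear[OF bounded_linear_cinner_right]])

lemma cinner_sum_left: "cinner (\<Sum>i\<in>I. f i) x = (\<Sum>i\<in>I. cinner (f i :: 'a::chilbert_space) x)"
proof -
  have "cinner (\<Sum>i\<in>I. f i) x = cnj (\<Sum>i\<in>I. cinner x (f i))"
    by (metis cinner_commute cinner_sum_right)
  then show ?thesis by (simp add: cinner_commute[symmetric])
qed

lemma cinner_eq_0_commute: "cinner x y = 0 \<longleftrightarrow> cinner y (x :: 'a::chilbert_space) = 0"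
  by (metis cinner_commute complex_cnj_zero)

lemma cinner_diff_left: "cinner (x - y) z = cinner x z - cinner y (z :: 'a::chilbert_space)"
  by (metis cinner_diff_right cinner_commute complex_cnj_diff)

lemma norm_add_sq_orthogonal:
  fixes x y :: "'a::chilbert_space"
  assumes "cinner x y = 0"
  shows "(norm (x + y))\<^sup>2 = (norm x)\<^sup>2 + (norm y)\<^sup>2"
  using assms by (simp add: power2_norm_eq_inner inner_add_left inner_add_right inner_commute
      inner_eq_Re_cinner[of x y])

lemma norm_sum_orthonormal_sq:
  fixes v :: "'i \<Rightarrow> 'a::chilbert_space"
  assumes fin: "finite I" and on: "\<And>i j. i \<in> I \<Longrightarrow> j \<in> I \<Longrightarrow> cinner (v i) (v j) = (if i = j then 1 else 0)"
  shows "(norm (\<Sum>i\<in>I. c i *\<^sub>C v i))\<^sup>2 = (\<Sum>i\<in>I. (cmod (c i))\<^sup>2)"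
proof -
  have "complex_of_real ((norm (\<Sum>i\<in>I. c i *\<^sub>C v i))\<^sup>2)
      = (\<Sum>i\<in>I. \<Sum>j\<in>I. cnj (c j) * (c i * cinner (v j) (v i)))"
    unfolding cinner_self[symmetric]
    by (simp add: cinner_sum_left cinner_sum_right cinner_scaleC_left cinner_scaleC_right
        sum_distrib_left mult.left_commute)
  also have "\<dots> = (\<Sum>i\<in>I. \<Sum>j\<in>I. if j = i then cnj (c i) * c i else 0)"
    by (intro sum.cong refl) (auto simp: on)
  also have "\<dots> = complex_of_real (\<Sum>i\<in>I. (cmod (c i))\<^sup>2)"
    using fin by (simp add: complex_norm_square[symmetric] mult.commute del: of_real_power)
  finally show ?thesis by (simp only: of_real_eq_iff)
qed

lemma bessel_inequality:
  fixes v :: "'i \<Rightarrow> 'a::chilbert_space"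
  assumes fin: "finite I" and on: "\<And>i j. i \<in> I \<Longrightarrow> j \<in> I \<Longrightarrow> cinner (v i) (v j) = (if i = j then 1 else 0)"
  shows "(\<Sum>i\<in>I. (cmod (cinner (v i) x))\<^sup>2) \<le> (norm x)\<^sup>2"
proof -
  define p where "p = (\<Sum>i\<in>I. cinner (v i) x *\<^sub>C v i)"
  have vp: "cinner (v i) p = cinner (v i) x" if "i \<in> I" for i
  proof -
    have "cinner (v i) p = (\<Sum>j\<in>I. if j = i then cinner (v i) x else 0)"
      unfolding p_def cinner_sum_right by (intro sum.cong refl) (auto simp: cinner_scaleC_right on that)
    then show ?thesis using fin that by simp
  qed
  have "cinner p (x - p) = 0"
    by (subst p_def) (simp add: cinner_sum_left cinner_scaleC_left cinner_diff_right vp)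
  from norm_add_sq_orthogonal[OF this] have "(norm p)\<^sup>2 \<le> (norm x)\<^sup>2" by simp
  moreover have "(norm p)\<^sup>2 = (\<Sum>i\<in>I. (cmod (cinner (v i) x))\<^sup>2)"
    unfolding p_def by (rule norm_sum_orthonormal_sq[OF fin on])
  ultimately show ?thesis by simp
qed

lemma orthonormal_expansion:
  fixes e :: "nat \<Rightarrow> 'a::chilbert_space"
  assumes "orthonormal_basis_of e n V" "x \<in> V"
  shows "(\<Sum>i<n. cinner (e i) x *\<^sub>C e i) = x"
proof -
  have on: "cinner (e i) (e j) = (if i = j then 1 else 0)" if "i < n" "j < n" for i j
    using assms(1) that by (simp add: orthonormal_basis_of_def)
  have "x \<in> complex_vector.span (e ` {..<n})" using assms by (simp add: orthonormal_basis_of_def)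
  then show ?thesis
  proof (induction rule: complex_vector.span_induct_alt)
    case base
    then show ?case by simp
  next
    case (step c y z)
    then obtain k where k: "k < n" "y = e k" by auto
    have "(\<Sum>i<n. cinner (e i) (c *\<^sub>C y + z) *\<^sub>C e i)
        = (\<Sum>i<n. (c * cinner (e i) y) *\<^sub>C e i) + (\<Sum>i<n. cinner (e i) z *\<^sub>C e i)"
      by (simp add: cinner_add_right cinner_scaleC_right scaleC_add_left sum.distrib)
    also have "(\<Sum>i<n. (c * cinner (e i) y) *\<^sub>C e i) = (\<Sum>i<n. if i = k then c *\<^sub>C y else 0)"
      by (intro sum.cong refl) (auto simp: k on)
    finally show ?case using k step by simp
  qed
qed

text \<open>
  Combined with \<open>orthonormal_expansion\<close>: the coefficients of \<open>P x\<close> in a basis of the range of \<open>P\<close>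
  are those of \<open>x\<close>, because \<open>P\<close> is self-adjoint and fixes the basis vectors.
\<close>

lemma projection_expansion:
  assumes "orthogonal_projection P" and e: "orthonormal_basis_of e n (range (blinfun_apply P))"
  shows "P x = (\<Sum>i<n. cinner (e i) x *\<^sub>C e i)"
proof -
  have PP: "P (P y) = P y" for y
    using assms(1) unfolding orthogonal_projection_def by (metis blinfun_apply_blinfun_compose)
  have "cinner (e i) (P x) = cinner (e i) x" if "i < n" for i
  proof -
    have "e i \<in> complex_vector.span (e ` {..<n})" using that by (intro complex_vector.span_base) auto
    then obtain y where "e i = P y" using e by (auto simp: orthonormal_basis_of_def)
    then have "P (e i) = e i" by (simp add: PP)
    then show ?thesis
      using assms(1) by (metis orthogonal_projection_def self_adjoint_def)
  qed
  then show ?thesis using orthonormal_expansion[OF e, of "P x"] by simp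
qed

lemma bounded_bilinear_cinner: "bounded_bilinear (cinner :: 'a::chilbert_space \<Rightarrow> 'a \<Rightarrow> complex)"
proof
  show "\<exists>K. \<forall>a b :: 'a. norm (cinner a b) \<le> norm a * norm b * K"
    by (intro exI[of _ 1] allI) (simp add: cinner_cauchy_schwarz)
qed (simp_all add: cinner_add_left cinner_add_right scaleR_scaleC cinner_scaleC_left cinner_scaleC_right
    scaleR_conv_of_real)

lemma bounded_operators_scaleC: "T \<in> bounded_operators \<Longrightarrow> T (c *\<^sub>C x) = c *\<^sub>C T x"
  by (simp add: bounded_operators_def)

section \<open>Unitary diagonalization and singular values\<close>

lemma unitary_matrix_mult:
  assumes U: "unitary_matrix n U" and V: "unitary_matrix n V"
  shows "unitary_matrix n (U * V)"
proof -
  have c: "U \<in> carrier_mat n n" "V \<in> carrier_mat n n" "mat_adjoint U \<in> carrier_mat n n" "mat_adjoint V \<in> carrier_mat n n"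
    and u: "mat_adjoint U * U = 1\<^sub>m n" "U * mat_adjoint U = 1\<^sub>m n"
      "mat_adjoint V * V = 1\<^sub>m n" "V * mat_adjoint V = 1\<^sub>m n"
    using assms by (auto simp: unitary_matrix_def)
  note assoc = assoc_mult_mat[of _ n n _ n _ n]
  have "mat_adjoint (U * V) * (U * V) = mat_adjoint V * (mat_adjoint U * U) * V"
    unfolding mat_adjoint_mult[OF c(1,2)] using c by (simp add: assoc mult_carrier_mat[of _ n n _ n])
  moreover have "U * V * mat_adjoint (U * V) = U * (V * mat_adjoint V) * mat_adjoint U"
    unfolding mat_adjoint_mult[OF c(1,2)] using c by (simp add: assoc mult_carrier_mat[of _ n n _ n])
  ultimately show ?thesis using c u by (simp add: unitary_matrix_def)
qed

lemma unitary_matrixI: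
  assumes U: "U \<in> carrier_mat n n" "mat_adjoint U * U = 1\<^sub>m n"
  shows "unitary_matrix n U"
  using mat_mult_left_right_inverse[OF mat_adjoint_carrier[OF U(1)] U(1,2)] U by (simp add: unitary_matrix_def)

text \<open>
  Gram--Schmidt applied to a completion of \<open>v\<close> to a basis keeps \<open>v\<close> in first place; it only remains
  to normalize the columns.
\<close>

lemma unitary_with_first_column:
  fixes v :: "complex Matrix.vec"
  assumes v: "v \<in> carrier_vec n" "v \<noteq> 0\<^sub>v n"
  obtains W c where "unitary_matrix n W" "col W 0 = c \<cdot>\<^sub>v v"
proof -
  interpret cof_vec_space n "TYPE(complex)" .
  define b where "b = basis_completion v"
  have b: "set b \<subseteq> carrier_vec n" "distinct b" "\<not> lin_dep (set b)" "length b = n" "hd b = v"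
    using basis_completion[OF v] by (auto simp: b_def)
  have "n \<noteq> 0" using v by (metis carrier_vec_dim_vec eq_vecI index_zero_vec(2) less_nat_zero_code carrier_vecD)
  then obtain vs where vs: "b = v # vs" using b(4,5) by (cases b) auto
  define ws where "ws = gram_schmidt n b"
  have ws: "set ws \<subseteq> carrier_vec n" "corthogonal ws" "length ws = n"
    using gram_schmidt_result[OF b(1,2,3) ws_def] b(4) by auto
  have hd: "hd ws = v" unfolding ws_def vs by (rule gram_schmidt_hd[OF v(1)])
  have ws0: "ws ! 0 = v" using hd ws(3) \<open>n \<noteq> 0\<close> by (metis hd_conv_nth list.size(3))
  define q where "q j = (\<Sum>k<n. (cmod (vec_index (ws ! j) k))\<^sup>2)" for j
  define W where "W = mat n n (\<lambda>(i, j). complex_of_real (1 / sqrt (q j)) * vec_index (ws ! j) i)"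
  have dim: "dim_vec (ws ! j) = n" if "j < n" for j using ws(1,3) that by (metis carrier_vecD nth_mem subsetD)
  have inner: "(\<Sum>k<n. cnj (vec_index (ws ! i) k) * vec_index (ws ! j) k) = (if i = j then complex_of_real (q i) else 0)"
    "q i \<noteq> 0" if ij: "i < n" "j < n" for i j
  proof -
    have sp: "ws ! j' \<bullet>c ws ! i = (\<Sum>k<n. cnj (vec_index (ws ! i) k) * vec_index (ws ! j') k)" if "j' < n" for j'
      using ij that by (simp add: scalar_prod_def dim lessThan_atLeast0 mult.commute)
    have self: "(\<Sum>k<n. cnj (vec_index (ws ! i) k) * vec_index (ws ! i) k) = complex_of_real (q i)"
      by (simp add: q_def complex_norm_square[symmetric] mult.commute del: of_real_power)
    have "ws ! i \<bullet>c ws ! i \<noteq> 0" using corthogonalD[OF ws(2)] ij ws(3) by auto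
    then show "q i \<noteq> 0" using sp[OF ij(1)] self by auto
    show "(\<Sum>k<n. cnj (vec_index (ws ! i) k) * vec_index (ws ! j) k) = (if i = j then complex_of_real (q i) else 0)"
      using corthogonalD[OF ws(2), of j i] ij ws(3) sp[OF ij(2)] self by auto
  qed
  have qpos: "0 < q i" if "i < n" for i
    using inner(2)[OF that that] by (metis q_def less_eq_real_def sum_nonneg zero_le_power2)
  have W: "W \<in> carrier_mat n n" by (simp add: W_def)
  have "mat_adjoint W * W = 1\<^sub>m n"
  proof (rule eq_matI)
    fix i j assume "i < dim_row (1\<^sub>m n :: complex mat)" "j < dim_col (1\<^sub>m n :: complex mat)"
    then have ij: "i < n" "j < n" by auto
    have "(mat_adjoint W * W) $$ (i, j)
        = complex_of_real (1 / sqrt (q i) * (1 / sqrt (q j))) * (\<Sum>k<n. cnj (vec_index (ws ! i) k) * vec_index (ws ! j) k)"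
      using ij W by (simp add: scalar_prod_def mat_adjoint_index lessThan_atLeast0 W_def sum_distrib_left mult_ac
          del: of_real_mult of_real_divide) (simp add: mult_ac)
    also have "\<dots> = 1\<^sub>m n $$ (i, j)"
      using ij qpos[OF ij(1)] qpos[OF ij(2)] by (simp add: inner(1)[OF ij] flip: of_real_mult)
    finally show "(mat_adjoint W * W) $$ (i, j) = 1\<^sub>m n $$ (i, j)" .
  qed (use W in auto)
  then have "unitary_matrix n W" using W by (rule unitary_matrixI[rotated])
  moreover have "col W 0 = complex_of_real (1 / sqrt (q 0)) \<cdot>\<^sub>v v"
    using \<open>n \<noteq> 0\<close> v(1) by (intro eq_vecI) (auto simp: W_def ws0)
  ultimately show thesis using that by blast
qed

lemma complex_matrix_has_eigenvector:
  fixes H :: "complex mat"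
  assumes H: "H \<in> carrier_mat n n" and n: "n \<noteq> 0"
  obtains v c where "v \<in> carrier_vec n" "v \<noteq> 0\<^sub>v n" "H *\<^sub>v v = c \<cdot>\<^sub>v v"
proof -
  have "\<not> constant (poly (char_poly H))"
    using degree_monic_char_poly[OF H] n by (simp add: constant_degree)
  then obtain c where "poly (char_poly H) c = 0" using fundamental_theorem_of_algebra by blast
  then have "eigenvalue H c" using eigenvalue_root_char_poly[OF H] by simp
  then show thesis using that H unfolding eigenvalue_def eigenvector_def by auto
qed

lemma adjoint_conj:
  fixes W H :: "complex mat"
  assumes "W \<in> carrier_mat n n" "H \<in> carrier_mat n n"
  shows "mat_adjoint (mat_adjoint W * H * W) = mat_adjoint W * mat_adjoint H * W"
proof -
  have c: "mat_adjoint W \<in> carrier_mat n n" "mat_adjoint H \<in> carrier_mat n n" using assms by auto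
  show ?thesis
    unfolding mat_adjoint_mult[OF mult_carrier_mat[OF c(1) assms(2)] assms(1)] mat_adjoint_mult[OF c(1) assms(2)]
      mat_adjoint_adjoint
    by (rule assoc_mult_mat[OF c assms(1), symmetric])
qed

text \<open>
  Induction on the size. A unitary matrix whose first column is a multiple of an eigenvector
  conjugates \<open>H\<close> to a matrix with only its first entry in the first column, hence, being Hermitian,
  also in the first row. The induction hypothesis diagonalizes the remaining block.
\<close>

theorem hermitian_unitarily_diagonalizable:
  fixes H :: "complex mat"
  assumes "H \<in> carrier_mat n n" "mat_adjoint H = H"
  shows "\<exists>U d. unitary_matrix n U \<and>
    mat_adjoint U * H * U = mat n n (\<lambda>(i, j). if i = j then d i else 0)"
  using assms
proof (induction n arbitrary: H)
  case 0
  then show ?case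
    by (intro exI[of _ "1\<^sub>m 0"] exI[of _ "\<lambda>_. 0"]) (auto simp: unitary_matrix_def intro!: eq_matI)
next
  case (Suc n)
  note H = Suc.prems
  obtain v c where v: "v \<in> carrier_vec (Suc n)" "v \<noteq> 0\<^sub>v (Suc n)" "H *\<^sub>v v = c \<cdot>\<^sub>v v"
    using complex_matrix_has_eigenvector[OF H(1)] by auto
  obtain W b where W: "unitary_matrix (Suc n) W" "col W 0 = b \<cdot>\<^sub>v v"
    using unitary_with_first_column[OF v(1,2)] by auto
  have Wc: "W \<in> carrier_mat (Suc n) (Suc n)" "mat_adjoint W \<in> carrier_mat (Suc n) (Suc n)"
    and WW: "mat_adjoint W * W = 1\<^sub>m (Suc n)"
    using W(1) by (auto simp: unitary_matrix_def)
  define A where "A = mat_adjoint W * H * W"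
  have A: "A \<in> carrier_mat (Suc n) (Suc n)" unfolding A_def using Wc H by auto
  have Ah: "mat_adjoint A = A" unfolding A_def using adjoint_conj[OF Wc(1) H(1)] H(2) by simp
  have col0: "A $$ (i, 0) = (if i = 0 then c else 0)" if i: "i < Suc n" for i
  proof -
    have "A $$ (i, 0) = row (mat_adjoint W) i \<bullet> col (H * W) 0"
      unfolding A_def assoc_mult_mat[OF Wc(2) H(1) Wc(1)] using i Wc H by simp
    also have "col (H * W) 0 = H *\<^sub>v col W 0" by (rule col_mult2[OF H(1) Wc(1)]) simp
    also have "\<dots> = c \<cdot>\<^sub>v col W 0"
      unfolding W(2) using H v by (simp add: mult_mat_vec smult_smult_assoc mult.commute)
    also have "row (mat_adjoint W) i \<bullet> (c \<cdot>\<^sub>v col W 0) = c * (mat_adjoint W * W) $$ (i, 0)"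
      using i Wc by simp
    finally show ?thesis using i by (simp add: WW)
  qed
  have row0: "A $$ (0, j) = (if j = 0 then c else 0)" if j: "j < Suc n" for j
  proof -
    have "A $$ (0, j) = cnj (A $$ (j, 0))"
      using mat_adjoint_index[of 0 A j] A j Ah by simp
    then show ?thesis using col0[OF j] col0[of 0] mat_adjoint_index[of 0 A 0] A Ah by auto
  qed
  define B where "B = mat n n (\<lambda>(i, j). A $$ (Suc i, Suc j))"
  have B: "B \<in> carrier_mat n n" by (simp add: B_def)
  have Bh: "mat_adjoint B = B"
  proof (rule eq_matI)
    fix i j assume "i < dim_row B" "j < dim_col B"
    then have ij: "i < n" "j < n" using B by auto
    have "mat_adjoint B $$ (i, j) = cnj (A $$ (Suc j, Suc i))" using ij B by (simp add: mat_adjoint_index) (simp add: B_def)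
    also have "\<dots> = mat_adjoint A $$ (Suc i, Suc j)" using ij A by (simp add: mat_adjoint_index)
    finally show "mat_adjoint B $$ (i, j) = B $$ (i, j)" using ij by (simp add: Ah B_def)
  qed (use B in auto)
  obtain V d where V: "unitary_matrix n V"
    "mat_adjoint V * B * V = mat n n (\<lambda>(i, j). if i = j then d i else 0)"
    using Suc.IH[OF B Bh] by auto
  have Vc: "V \<in> carrier_mat n n" "mat_adjoint V \<in> carrier_mat n n" and VV: "mat_adjoint V * V = 1\<^sub>m n"
    using V(1) by (auto simp: unitary_matrix_def)
  let ?blk = "\<lambda>a X. four_block_mat (mat 1 1 (\<lambda>_. a)) (0\<^sub>m 1 n) (0\<^sub>m n 1) X :: complex mat"
  have mult_blk: "?blk a X * ?blk a' Y = ?blk (a * a') (X * Y)" if "X \<in> carrier_mat n n" "Y \<in> carrier_mat n n" for a a' X Y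
  proof -
    have m1: "mat 1 1 (\<lambda>_. a) * mat 1 1 (\<lambda>_. a') = (mat 1 1 (\<lambda>_. a * a') :: complex mat)"
      by (intro eq_matI) (auto simp: scalar_prod_def)
    show ?thesis
      by (subst mult_four_block_mat[of _ 1 1 _ n _ n _ _ 1 _ n]) (use that in \<open>auto simp: m1 simp del: One_nat_def\<close>)
  qed
  have adj_blk: "mat_adjoint (?blk 1 V) = ?blk 1 (mat_adjoint V)"
    using Vc by (intro eq_matI) (auto simp: mat_adjoint_index)
  have A_blk: "A = ?blk c B"
    using A B by (intro eq_matI) (auto simp: B_def col0 row0 less_Suc_eq_0_disj)
  have one_blk: "?blk 1 (1\<^sub>m n) = 1\<^sub>m (Suc n)"
    by (intro eq_matI) auto
  define V' where "V' = ?blk 1 V"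
  have V': "V' \<in> carrier_mat (Suc n) (Suc n)" unfolding V'_def using Vc by (intro carrier_matI) auto
  have V'u: "unitary_matrix (Suc n) V'"
  proof (rule unitary_matrixI[OF V'])
    show "mat_adjoint V' * V' = 1\<^sub>m (Suc n)"
      unfolding V'_def adj_blk by (simp add: mult_blk Vc VV one_blk del: One_nat_def)
  qed
  have "mat_adjoint (W * V') * H * (W * V') = mat_adjoint V' * A * V'"
    unfolding A_def mat_adjoint_mult[OF Wc(1) V'] using Wc V' H
    by (simp add: assoc_mult_mat[of _ "Suc n" "Suc n" _ "Suc n" _ "Suc n"]
        mult_carrier_mat[of _ "Suc n" "Suc n" _ "Suc n"])
  also have "\<dots> = ?blk c (mat_adjoint V * B * V)"
    unfolding V'_def adj_blk A_blk using Vc B by (simp add: mult_blk mult_carrier_mat[of _ n n _ n] del: One_nat_def)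
  also have "\<dots> = mat (Suc n) (Suc n) (\<lambda>(i, j). if i = j then (case i of 0 \<Rightarrow> c | Suc k \<Rightarrow> d k) else 0)"
    unfolding V(2) by (intro eq_matI) (auto simp: less_Suc_eq_0_disj split: if_splits)
  finally show ?case
    using unitary_matrix_mult[OF W(1) V'u] by (intro exI[of _ "W * V'"] exI[of _ "case_nat c d"]) simp
qed

lemma proots_char_poly_diagonalized:
  assumes U: "unitary_matrix n U" and H: "H \<in> carrier_mat n n"
    and d: "mat_adjoint U * H * U = mat n n (\<lambda>(i, j). if i = j then d i else 0)"
  shows "proots (char_poly H) = image_mset d (mset [0..<n])"
proof -
  let ?D = "mat n n (\<lambda>(i, j). if i = j then d i else 0)"
  have Uc: "U \<in> carrier_mat n n" "mat_adjoint U \<in> carrier_mat n n"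
    and u: "mat_adjoint U * U = 1\<^sub>m n" "U * mat_adjoint U = 1\<^sub>m n"
    using U by (auto simp: unitary_matrix_def)
  have "similar_mat ?D H"
    unfolding similar_mat_def similar_mat_wit_def Let_def
    using Uc u H d by (intro exI[of _ "mat_adjoint U"] exI[of _ U]) auto
  then have "char_poly H = char_poly ?D" by (metis char_poly_similar)
  also have "\<dots> = (\<Prod>a\<leftarrow>diag_mat ?D. [:- a, 1:])"
    by (rule char_poly_upper_triangular[of _ n]) (auto simp: upper_triangular_def)
  also have "diag_mat ?D = map d [0..<n]" by (auto simp: diag_mat_def)
  finally have "proots (char_poly H) = (\<Sum>p\<leftarrow>map (\<lambda>i. [:- d i, 1:]) [0..<n]. proots p)"
    by (subst proots_prod_list[symmetric]) (auto simp: comp_def)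
  also have "\<dots> = image_mset d (mset [0..<n])"
    by (induction n) (auto simp: proots_linear_factor)
  finally show ?thesis .
qed

text \<open>
  The functionals \<open>w\<close> are the coordinates along those eigenvectors of \<open>K\<^sup>* K\<close> that belong to
  singular values outside \<open>[0, \<epsilon>)\<close>. Where they vanish, only eigenvalues up to \<open>\<epsilon>\<^sup>2\<close> contribute to
  the quadratic form \<open>\<langle>x, K\<^sup>* K x\<rangle>\<close>, the squared length of \<open>K x\<close>. Functionals are kept as
  coefficient functions so that they can be evaluated on the coordinates of a Hilbert space vector.
\<close>

lemma quadratic_bound_off_large_singular_values:
  fixes K :: "complex mat"
  assumes K: "K \<in> carrier_mat n n" and \<epsilon>: "0 < \<epsilon>"
    and N: "size {#s \<in># singular_values K. s \<notin> {0..<\<epsilon>}#} \<le> N"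
  obtains W where "finite W" "card W \<le> N"
    "\<And>x. (\<forall>w\<in>W. (\<Sum>k<n. w k * x k) = 0) \<Longrightarrow>
      (\<Sum>i<n. (cmod (\<Sum>j<n. K $$ (i, j) * x j))\<^sup>2) \<le> \<epsilon>\<^sup>2 * (\<Sum>j<n. (cmod (x j))\<^sup>2)"
proof -
  define H where "H = mat_adjoint K * K"
  have Kc: "mat_adjoint K \<in> carrier_mat n n" using K by simp
  have H: "H \<in> carrier_mat n n" unfolding H_def using K by auto
  have Hh: "mat_adjoint H = H" unfolding H_def mat_adjoint_mult[OF Kc K] mat_adjoint_adjoint ..
  obtain U d where U: "unitary_matrix n U"
    "mat_adjoint U * H * U = mat n n (\<lambda>(i, j). if i = j then d i else 0)"
    using hermitian_unitarily_diagonalizable[OF H Hh] by auto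
  have Uc: "U \<in> carrier_mat n n" "mat_adjoint U \<in> carrier_mat n n"
    and u: "mat_adjoint U * U = 1\<^sub>m n" "U * mat_adjoint U = 1\<^sub>m n"
    using U by (auto simp: unitary_matrix_def)
  define bad where "bad = {i\<in>{..<n}. sqrt (Re (d i)) \<notin> {0..<\<epsilon>}}"
  have "card bad = size {#s \<in># singular_values K. s \<notin> {0..<\<epsilon>}#}"
    unfolding singular_values_def H_def[symmetric] proots_char_poly_diagonalized[OF U(1) H U(2)]
    by (simp add: bad_def filter_mset_image_mset multiset.map_comp mset_upt lessThan_atLeast0)
  then have bad: "finite bad" "card bad \<le> N" using N by (auto simp: bad_def)
  define W where "W = (\<lambda>i k. cnj (U $$ (k, i))) ` bad"
  have "(\<Sum>i<n. (cmod (\<Sum>j<n. K $$ (i, j) * x j))\<^sup>2) \<le> \<epsilon>\<^sup>2 * (\<Sum>j<n. (cmod (x j))\<^sup>2)"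
    if x: "\<forall>w\<in>W. (\<Sum>k<n. w k * x k) = 0" for x
  proof -
    \<comment> \<open>As an \<open>n \<times> 1\<close> matrix the vector has its length as Frobenius norm, which is invariant under \<open>U\<close>.\<close>
    define X where "X = mat n 1 (\<lambda>(i, _). x i)"
    have X: "X \<in> carrier_mat n 1" by (simp add: X_def)
    define Y where "Y = mat_adjoint U * X"
    have Y: "Y \<in> carrier_mat n 1" unfolding Y_def using Uc(2) X by (rule mult_carrier_mat)
    have UY: "U * Y = X" unfolding Y_def using Uc X u by (simp flip: assoc_mult_mat[of _ n n _ n _ 1])
    have Y0: "Y $$ (i, 0) = 0" if "i \<in> bad" for i
      using x that Uc X by (simp add: Y_def W_def bad_def scalar_prod_def mat_adjoint_index lessThan_atLeast0)
        (simp add: X_def)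
    have fX: "(frobenius_norm X)\<^sup>2 = (\<Sum>j<n. (cmod (x j))\<^sup>2)"
      unfolding frobenius_norm_sq by (simp add: X_def)
    have fY: "(frobenius_norm X)\<^sup>2 = (\<Sum>j<n. (cmod (Y $$ (j, 0)))\<^sup>2)"
      unfolding UY[symmetric] frobenius_norm_unitary_left[OF Uc(1) u(1) Y] frobenius_norm_sq using Y by simp
    have fK: "(frobenius_norm (K * X))\<^sup>2 = (\<Sum>i<n. (cmod (\<Sum>j<n. K $$ (i, j) * x j))\<^sup>2)"
      unfolding frobenius_norm_sq using K X by (simp add: scalar_prod_def lessThan_atLeast0) (simp add: X_def)
    have Yc: "mat_adjoint Y \<in> carrier_mat 1 n" using Y by simp
    have XU: "mat_adjoint X = mat_adjoint Y * mat_adjoint U" unfolding UY[symmetric] by (rule mat_adjoint_mult[OF Uc(1) Y])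
    have "mat_adjoint (K * X) * (K * X) = mat_adjoint X * H * X"
      unfolding mat_adjoint_mult[OF K X] H_def using K Kc X mat_adjoint_carrier[OF X]
      by (simp add: assoc_mult_mat[of _ 1 n _ n _ 1] assoc_mult_mat[of _ 1 n _ n _ n] assoc_mult_mat[of _ n n _ n _ 1]
          mult_carrier_mat[of _ n n _ n] del: One_nat_def)
    also have "\<dots> = mat_adjoint Y * (mat_adjoint U * H * U) * Y"
      unfolding XU using UY[symmetric] Uc Y Yc H
      by (simp add: assoc_mult_mat[of _ 1 n _ n _ 1] assoc_mult_mat[of _ 1 n _ n _ n] assoc_mult_mat[of _ n n _ n _ 1]
          assoc_mult_mat[of _ n n _ n _ n] mult_carrier_mat[of _ n n _ n] del: One_nat_def)
    finally have gram: "mat_adjoint (K * X) * (K * X) = mat_adjoint Y * (mat_adjoint U * H * U) * Y" .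
    have "complex_of_real ((frobenius_norm (K * X))\<^sup>2) = (mat_adjoint Y * (mat_adjoint U * H * U) * Y) $$ (0, 0)"
      unfolding frobenius_norm_gram gram using X K by simp
    also have "\<dots> = (\<Sum>i<n. d i * complex_of_real ((cmod (Y $$ (i, 0)))\<^sup>2))"
    proof -
      have dY: "((mat_adjoint U * H * U) * Y) $$ (i, 0) = d i * Y $$ (i, 0)" if "i < n" for i
      proof -
        have "((mat_adjoint U * H * U) * Y) $$ (i, 0) = (\<Sum>j<n. (if i = j then d i else 0) * Y $$ (j, 0))"
          unfolding U(2) using Y that by (simp add: scalar_prod_def lessThan_atLeast0)
        also have "\<dots> = (\<Sum>j<n. if j = i then d i * Y $$ (i, 0) else 0)"
          by (intro sum.cong refl) auto
        finally show ?thesis using that by simp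
      qed
      have Dc: "mat_adjoint U * H * U \<in> carrier_mat n n" unfolding U(2) by simp
      have "(mat_adjoint Y * (mat_adjoint U * H * U) * Y) $$ (0, 0)
          = (mat_adjoint Y * ((mat_adjoint U * H * U) * Y)) $$ (0, 0)"
        using assoc_mult_mat[OF Yc Dc Y] by simp
      also have "\<dots> = (\<Sum>i<n. cnj (Y $$ (i, 0)) * ((mat_adjoint U * H * U) * Y) $$ (i, 0))"
      proof -
        define M where "M = (mat_adjoint U * H * U) * Y"
        have "M \<in> carrier_mat n 1" unfolding M_def by (rule mult_carrier_mat[OF Dc Y])
        then show ?thesis
          unfolding M_def[symmetric] using Y by (simp add: scalar_prod_def lessThan_atLeast0 mat_adjoint_index)
      qed
      also have "\<dots> = (\<Sum>i<n. d i * complex_of_real ((cmod (Y $$ (i, 0)))\<^sup>2))"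
        by (intro sum.cong refl) (simp add: dY complex_norm_square mult_ac del: of_real_power)
      finally show ?thesis .
    qed
    finally have "(frobenius_norm (K * X))\<^sup>2 = Re (\<Sum>i<n. d i * complex_of_real ((cmod (Y $$ (i, 0)))\<^sup>2))"
      by (metis Re_complex_of_real)
    also have "\<dots> = (\<Sum>i<n. Re (d i) * (cmod (Y $$ (i, 0)))\<^sup>2)" by simp
    also have "\<dots> \<le> (\<Sum>i<n. \<epsilon>\<^sup>2 * (cmod (Y $$ (i, 0)))\<^sup>2)"
    proof (rule sum_mono)
      fix i assume i: "i \<in> {..<n}"
      show "Re (d i) * (cmod (Y $$ (i, 0)))\<^sup>2 \<le> \<epsilon>\<^sup>2 * (cmod (Y $$ (i, 0)))\<^sup>2"
      proof (cases "i \<in> bad")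
        case False
        then have "sqrt (Re (d i)) < \<epsilon>" using i by (simp add: bad_def)
        then have "Re (d i) \<le> \<epsilon>\<^sup>2" using \<epsilon> by (metis less_eq_real_def real_less_lsqrt real_sqrt_less_iff real_sqrt_pow2 real_sqrt_abs abs_of_pos)
        then show ?thesis by (rule mult_right_mono) simp
      qed (simp add: Y0)
    qed
    also have "\<dots> = \<epsilon>\<^sup>2 * (frobenius_norm X)\<^sup>2" unfolding fY by (simp add: sum_distrib_left)
    finally show ?thesis unfolding fK fX .
  qed
  moreover have "card W \<le> N" "finite W"
    using card_image_le[OF bad(1), of "\<lambda>i k. cnj (U $$ (k, i))"] bad by (auto simp: W_def)
  ultimately show thesis using that by blast
qed

section \<open>Operators given by matrices\<close>

lemma op_of_compression:
  assumes P: "orthogonal_projection (P n)"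
    and e: "orthonormal_basis_of (e n) n (range (blinfun_apply (P n)))"
    and A: "A \<in> bounded_operators"
  shows "op_of_matrix (e n) n (compression P e n A) = P n o\<^sub>L A o\<^sub>L P n"
proof (rule blinfun_eqI)
  fix x
  let ?B = "P n o\<^sub>L A o\<^sub>L P n"
  have lin: "?B (c *\<^sub>C y) = c *\<^sub>C ?B y" for c y
    using P A by (simp add: orthogonal_projection_def bounded_operators_def)
  have PP: "P n (P n y) = P n y" for y
    using P unfolding orthogonal_projection_def by (metis blinfun_apply_blinfun_compose)
  have "?B x = ?B (P n x)" by (simp add: PP)
  also have "\<dots> = (\<Sum>j<n. cinner (e n j) x *\<^sub>C ?B (e n j))"
    by (subst projection_expansion[OF P e]) (simp add: blinfun.sum_right lin del: blinfun_apply_blinfun_compose)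
  finally have 1: "?B x = (\<Sum>j<n. cinner (e n j) x *\<^sub>C ?B (e n j))" .
  have "?B x = P n (?B x)" by (simp add: PP)
  also have "\<dots> = (\<Sum>i<n. cinner (e n i) (?B x) *\<^sub>C e n i)" by (rule projection_expansion[OF P e])
  also have "\<dots> = (\<Sum>i<n. \<Sum>j<n. (cinner (e n i) (?B (e n j)) * cinner (e n j) x) *\<^sub>C e n i)"
    by (subst 1) (simp add: cinner_sum_right cinner_scaleC_right complex_vector.scale_sum_left mult.commute
        del: blinfun_apply_blinfun_compose)
  also have "\<dots> = op_of_matrix (e n) n (compression P e n A) x"
    unfolding op_of_matrix.rep_eq by (simp add: compression_def matrix_of_op_def)
  finally show "op_of_matrix (e n) n (compression P e n A) x = ?B x" by simp
qed

lemma op_of_matrix_bounded_operator: "op_of_matrix e n X \<in> bounded_operators"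
  by (simp add: bounded_operators_def op_of_matrix.rep_eq cinner_scaleC_right scaleC_scaleC
      complex_vector.scale_sum_right mult_ac)

lemma op_of_matrix_diff:
  assumes "Y \<in> carrier_mat n n"
  shows "op_of_matrix e n (X - Y) = op_of_matrix e n X - op_of_matrix e n Y"
proof (rule blinfun_eqI)
  fix v
  show "op_of_matrix e n (X - Y) v = (op_of_matrix e n X - op_of_matrix e n Y) v"
    using carrier_matD[OF assms]
    by (simp add: op_of_matrix.rep_eq minus_blinfun.rep_eq left_diff_distrib
        complex_vector.scale_left_diff_distrib sum_subtractf)
qed

lemma diff_bounded_operators:
  "S \<in> bounded_operators \<Longrightarrow> T \<in> bounded_operators \<Longrightarrow> S - T \<in> bounded_operators"
  by (simp add: bounded_operators_def minus_blinfun.rep_eq complex_vector.scale_right_diff_distrib)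

lemma compression_wot_tendsto:
  assumes P: "\<And>n. orthogonal_projection (P n)" "\<And>x. (\<lambda>n. P n x) \<longlonglongrightarrow> x"
  shows "wot_tendsto (\<lambda>n. P n o\<^sub>L A o\<^sub>L P n) A sequentially"
  unfolding wot_tendsto_def
proof (intro allI)
  fix x y
  have "cinner x ((P n o\<^sub>L A o\<^sub>L P n) y) = cinner (P n x) (A (P n y))" for n
    using P(1)[of n] by (simp add: orthogonal_projection_def self_adjoint_def)
  then show "(\<lambda>n. cinner x ((P n o\<^sub>L A o\<^sub>L P n) y)) \<longlonglongrightarrow> cinner x (A y)"
    by (simp only:) (intro bounded_bilinear.tendsto[OF bounded_bilinear_cinner] blinfun.tendsto tendsto_const P(2))
qed

lemma net_filter_neq_bot:
  assumes "directed_set D R"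
  shows "net_filter D R \<noteq> bot"
proof
  assume "net_filter D R = bot"
  then have "eventually (\<lambda>_. False) (net_filter D R)" by simp
  then show False using assms unfolding eventually_net_filter[OF assms] directed_set_def by blast
qed

section \<open>Operators small on a subspace of finite codimension\<close>

text \<open>
  This bounds the \<open>(N + 1)\<close>-st approximation number of \<open>S\<close> by \<open>\<epsilon>\<close>. The bound \<open>N\<close> on the codimension is explicit since in the application it is uniform in a
  family of operators while the vectors \<open>F\<close> are not.
\<close>

definition small_on_codim :: "real \<Rightarrow> nat \<Rightarrow> ('a::chilbert_space \<Rightarrow>\<^sub>L 'a) \<Rightarrow> bool" where
  "small_on_codim \<epsilon> N S \<longleftrightarrow> (\<exists>F. finite F \<and> card F \<le> N \<and>
     (\<forall>x. (\<forall>f\<in>F. cinner f x = 0) \<longrightarrow> norm (S x) \<le> \<epsilon> * norm x))"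

lemma small_on_codim_op_of_matrix:
  assumes e: "orthonormal_basis_of e n V" and \<epsilon>: "0 \<le> \<epsilon>"
    and W: "finite W" "card W \<le> N"
    and K: "\<And>x. (\<forall>w\<in>W. (\<Sum>k<n. w k * x k) = 0) \<Longrightarrow>
      (\<Sum>i<n. (cmod (\<Sum>j<n. K $$ (i, j) * x j))\<^sup>2) \<le> \<epsilon>\<^sup>2 * (\<Sum>j<n. (cmod (x j))\<^sup>2)"
  shows "small_on_codim \<epsilon> N (op_of_matrix e n K)"
proof -
  have on: "cinner (e i) (e j) = (if i = j then 1 else 0)" if "i \<in> {..<n}" "j \<in> {..<n}" for i j
    using e that by (simp add: orthonormal_basis_of_def)
  define f where "f w = (\<Sum>k<n. cnj (w k) *\<^sub>C e k)" for w
  have "norm (op_of_matrix e n K x) \<le> \<epsilon> * norm x" if x: "\<forall>g\<in>f ` W. cinner g x = 0" for x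
  proof -
    have "\<forall>w\<in>W. (\<Sum>k<n. w k * cinner (e k) x) = 0"
      using x by (simp add: f_def cinner_sum_left cinner_scaleC_left)
    note K[OF this]
    also have "(\<Sum>i<n. (cmod (\<Sum>j<n. K $$ (i, j) * cinner (e j) x))\<^sup>2) = (norm (op_of_matrix e n K x))\<^sup>2"
      unfolding op_of_matrix.rep_eq complex_vector.scale_sum_left[symmetric]
      by (rule norm_sum_orthonormal_sq[OF _ on, symmetric]) auto
    also have "\<epsilon>\<^sup>2 * (\<Sum>j<n. (cmod (cinner (e j) x))\<^sup>2) \<le> \<epsilon>\<^sup>2 * (norm x)\<^sup>2"
      by (intro mult_left_mono bessel_inequality on) auto
    finally have "(norm (op_of_matrix e n K x))\<^sup>2 \<le> (\<epsilon> * norm x)\<^sup>2" by (simp add: power_mult_distrib)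
    then show ?thesis by (rule power2_le_imp_le) (simp add: \<epsilon>)
  qed
  moreover have "card (f ` W) \<le> N" using card_image_le[OF W(1), of f] W(2) by simp
  ultimately show ?thesis unfolding small_on_codim_def using W(1) by (intro exI[of _ "f ` W"]) blast
qed

text \<open>
  Fewer homogeneous equations than unknowns: padded with zero rows to a square matrix, the system has
  determinant \<open>0\<close>.
\<close>

lemma exists_nontrivial_solution:
  fixes a :: "'b \<Rightarrow> nat \<Rightarrow> complex"
  assumes "finite F" "card F \<le> N"
  shows "\<exists>c. (\<exists>j\<le>N. c j \<noteq> 0) \<and> (\<forall>f\<in>F. (\<Sum>j\<le>N. c j * a f j) = 0)"
proof -
  obtain g where g: "bij_betw g {..<card F} F"
    using ex_bij_betw_nat_finite[OF assms(1)] by (auto simp: lessThan_atLeast0)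
  define M where "M = mat (Suc N) (Suc N) (\<lambda>(i, j). if i < card F then a (g i) j else 0)"
  have M: "M \<in> carrier_mat (Suc N) (Suc N)" by (simp add: M_def)
  have "transpose_mat M *\<^sub>v unit_vec (Suc N) N = 0\<^sub>v (Suc N)"
    using assms(2) by (intro eq_vecI) (auto simp: M_def scalar_prod_def unit_vec_def intro!: sum.neutral)
  moreover have "unit_vec (Suc N) N \<noteq> (0\<^sub>v (Suc N) :: complex vec)"
    by (metis index_unit_vec(1) index_zero_vec(1) lessI zero_neq_one)
  ultimately have "det (transpose_mat M) = 0"
    using det_0_iff_vec_prod_zero_field[of "transpose_mat M" "Suc N"] M
    by (metis transpose_carrier_mat unit_vec_carrier)
  then have "det M = 0" using det_transpose[OF M] by simp
  then obtain v where v: "v \<in> carrier_vec (Suc N)" "v \<noteq> 0\<^sub>v (Suc N)" "M *\<^sub>v v = 0\<^sub>v (Suc N)"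
    using det_0_iff_vec_prod_zero_field[OF M] by auto
  have "(\<Sum>j\<le>N. vec_index v j * a f j) = 0" if "f \<in> F" for f
  proof -
    have "f \<in> g ` {..<card F}" unfolding bij_betw_imp_surj_on[OF g] by (rule that)
    then obtain i where i: "i < card F" "f = g i" by auto
    have "vec_index (M *\<^sub>v v) i = (\<Sum>j<Suc N. M $$ (i, j) * vec_index v j)"
      using i v(1) assms(2) M by (simp add: scalar_prod_def lessThan_atLeast0 del: sum.op_ivl_Suc sum.lessThan_Suc)
    also have "\<dots> = (\<Sum>j\<le>N. vec_index v j * a f j)"
      unfolding lessThan_Suc_atMost using i assms(2) by (intro sum.cong refl) (simp add: M_def)
    finally have "vec_index (M *\<^sub>v v) i = (\<Sum>j\<le>N. vec_index v j * a f j)" .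
    then show ?thesis using v(3) i assms(2) by simp
  qed
  moreover have "\<exists>j\<le>N. vec_index v j \<noteq> 0"
  proof (rule ccontr)
    assume "\<not> (\<exists>j\<le>N. vec_index v j \<noteq> 0)"
    then have "v = 0\<^sub>v (Suc N)" using v(1) by (intro eq_vecI) auto
    then show False using v(2) by simp
  qed
  ultimately show ?thesis by (intro exI[of _ "\<lambda>j. vec_index v j"]) blast
qed

section \<open>A compactness criterion\<close>

text \<open>
  Bounded pieces of a finite-dimensional space are relatively compact. The ambient space may be
  infinite-dimensional, so the compact set is built by adding one direction at a time.
\<close>

lemma compact_superset_of_bounded_combinations:
  fixes C :: "'a::real_normed_vector set" and r :: "'a \<Rightarrow> real"
  assumes "finite C"
  shows "\<exists>K. compact K \<and> (\<forall>a. (\<forall>c\<in>C. \<bar>a c\<bar> \<le> r c) \<longrightarrow> (\<Sum>c\<in>C. a c *\<^sub>R c) \<in> K)"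
  using assms
proof (induction C rule: finite_induct)
  case empty
  then show ?case by (intro exI[of _ "{0}"]) simp
next
  case (insert c C)
  then obtain K where K: "compact K" "\<And>a. \<forall>c\<in>C. \<bar>a c\<bar> \<le> r c \<Longrightarrow> (\<Sum>c\<in>C. a c *\<^sub>R c) \<in> K"
    by blast
  let ?L = "(\<lambda>p. fst p *\<^sub>R c + snd p) ` ({- r c..r c} \<times> K)"
  have "(\<Sum>d\<in>insert c C. a d *\<^sub>R d) \<in> ?L" if a: "\<forall>d\<in>insert c C. \<bar>a d\<bar> \<le> r d" for a
  proof (rule image_eqI)
    show "(\<Sum>d\<in>insert c C. a d *\<^sub>R d) = fst (a c, \<Sum>d\<in>C. a d *\<^sub>R d) *\<^sub>R c + snd (a c, \<Sum>d\<in>C. a d *\<^sub>R d)"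
      using insert(1,2) by simp
    have "\<bar>a c\<bar> \<le> r c" using a by simp
    then show "(a c, \<Sum>d\<in>C. a d *\<^sub>R d) \<in> {- r c..r c} \<times> K"
      using K(2)[of a] a by (simp add: abs_le_iff)
  qed
  moreover have "compact ?L"
    by (intro compact_continuous_image compact_Times K(1) compact_Icc continuous_intros)
  ultimately show ?case by blast
qed

lemma compact_closure_if_approximable:
  fixes S :: "'a::complete_space set"
  assumes "\<And>\<epsilon>. 0 < \<epsilon> \<Longrightarrow> \<exists>K. compact K \<and> (\<forall>x\<in>S. \<exists>y\<in>K. dist x y \<le> \<epsilon>)"
  shows "compact (closure S)"
  unfolding compact_eq_totally_bounded
proof (intro conjI allI impI)
  show "complete (closure S)" by (simp add: complete_eq_closed)
  fix \<epsilon> :: real assume \<epsilon>: "0 < \<epsilon>"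
  obtain K where K: "compact K" "\<forall>x\<in>S. \<exists>y\<in>K. dist x y \<le> \<epsilon> / 4"
    using assms[of "\<epsilon> / 4"] \<epsilon> by auto
  obtain k where k: "finite k" "K \<subseteq> (\<Union>z\<in>k. ball z (\<epsilon> / 4))"
    using K(1) \<epsilon> unfolding compact_eq_totally_bounded by (metis divide_pos_pos zero_less_numeral)
  have "closure S \<subseteq> (\<Union>z\<in>k. ball z \<epsilon>)"
  proof
    fix x assume "x \<in> closure S"
    then obtain x' where x': "x' \<in> S" "dist x' x < \<epsilon> / 4"
      using \<epsilon> unfolding closure_approachable by (meson divide_pos_pos zero_less_numeral)
    then obtain y where y: "y \<in> K" "dist x' y \<le> \<epsilon> / 4" using K by auto
    then obtain z where z: "z \<in> k" "dist z y < \<epsilon> / 4" using k by auto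
    have "dist z x < \<epsilon>" using x' y z \<epsilon> by metric
    then show "x \<in> (\<Union>z\<in>k. ball z \<epsilon>)" using z by auto
  qed
  then show "\<exists>k. finite k \<and> closure S \<subseteq> (\<Union>z\<in>k. ball z \<epsilon>)" using k by auto
qed

text \<open>
  The component \<open>p\<close> of \<open>x\<close> in the span of \<open>F\<close> ranges over a compact set, and \<open>x - p\<close> is orthogonal
  to \<open>F\<close>. Complex orthogonality to \<open>f\<close> is real orthogonality to \<open>f\<close> and \<open>\<i> f\<close>, so that real
  orthogonalization suffices.
\<close>

lemma finite_orthogonal_decomposition:
  fixes F :: "'a::chilbert_space set"
  assumes "finite F"
  obtains K where "compact K"
    "\<And>x. norm x \<le> 1 \<Longrightarrow> \<exists>p\<in>K. norm (x - p) \<le> 1 \<and> (\<forall>f\<in>F. cinner f (x - p) = 0)"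
proof -
  obtain C where C: "finite C" "span C = span (F \<union> (\<lambda>f. \<i> *\<^sub>C f) ` F)" "pairwise real_inner_class.orthogonal C"
    using basis_orthogonal[of "F \<union> (\<lambda>f. \<i> *\<^sub>C f) ` F"] assms by auto
  obtain K where K: "compact K" "\<And>a. \<forall>c\<in>C. \<bar>a c\<bar> \<le> 1 / norm c \<Longrightarrow> (\<Sum>c\<in>C. a c *\<^sub>R c) \<in> K"
    using compact_superset_of_bounded_combinations[OF C(1), of "\<lambda>c. 1 / norm c"] by blast
  have "\<exists>p\<in>K. norm (x - p) \<le> 1 \<and> (\<forall>f\<in>F. cinner f (x - p) = 0)" if x: "norm x \<le> 1" for x
  proof -
    define a where "a c = inner c x / inner c c" for c
    define p where "p = (\<Sum>c\<in>C. a c *\<^sub>R c)"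
    have "\<bar>a c\<bar> \<le> 1 / norm c" for c
    proof (cases "c = 0")
      case False
      have "\<bar>inner c x\<bar> \<le> norm c * norm x" by (rule Cauchy_Schwarz_ineq2)
      also have "\<dots> \<le> norm c * 1" using x by (intro mult_left_mono) auto
      finally have "\<bar>inner c x\<bar> / (norm c)\<^sup>2 \<le> norm c / (norm c)\<^sup>2"
        by (intro divide_right_mono) auto
      then show ?thesis using False by (simp add: a_def power2_norm_eq_inner[symmetric] power2_eq_square)
    qed (simp add: a_def)
    then have pK: "p \<in> K" unfolding p_def by (intro K(2)) simp
    have cp: "inner c p = inner c x" if "c \<in> C" for c
    proof -
      have "inner c p = (\<Sum>d\<in>C. if d = c then a c * inner c c else 0)"
        unfolding p_def inner_sum_right using C(3) that
        by (intro sum.cong refl) (auto simp: pairwise_def real_inner_class.orthogonal_def)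
      also have "\<dots> = inner c x" using C(1) that by (simp add: a_def)
      finally show ?thesis .
    qed
    have "real_inner_class.orthogonal (x - p) c" if "c \<in> C" for c
      unfolding real_inner_class.orthogonal_def inner_commute[of _ c] inner_diff_right cp[OF that] by simp
    then have orth: "inner f (x - p) = 0" if "f \<in> span C" for f
      using orthogonal_to_span[OF that, of "x - p"]
      by (simp add: real_inner_class.orthogonal_def inner_commute[of f])
    have "cinner f (x - p) = 0" if "f \<in> F" for f
    proof -
      have "f \<in> span C" "\<i> *\<^sub>C f \<in> span C" unfolding C(2) using that by (auto intro: span_base)
      from this[THEN orth] show ?thesis
        by (simp add: inner_eq_Re_cinner cinner_scaleC_left complex_eq_iff)
    qed
    moreover have "norm (x - p) \<le> 1"
    proof -
      have "p \<in> span C" unfolding p_def by (intro span_sum span_scale span_base)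
      then have "inner p (x - p) = 0" by (rule orth)
      then have "(norm x)\<^sup>2 = (norm p)\<^sup>2 + (norm (x - p))\<^sup>2"
        by (simp add: power2_norm_eq_inner inner_diff_left inner_diff_right inner_commute)
      then have "(norm (x - p))\<^sup>2 \<le> (norm x)\<^sup>2" by simp
      then have "norm (x - p) \<le> norm x" by (rule power2_le_imp_le) simp
      then show ?thesis using x by simp
    qed
    ultimately show ?thesis using pK by blast
  qed
  then show thesis using that K(1) by blast
qed

text \<open>
  Up to \<open>\<epsilon>\<close> the image of the unit ball is the image of the compact set of components along \<open>F\<close>.
\<close>

lemma compact_operatorI:
  assumes T: "T \<in> bounded_operators"
    and small: "\<And>\<epsilon>. 0 < \<epsilon> \<Longrightarrow> \<exists>F. finite F \<and> (\<forall>x. (\<forall>f\<in>F. cinner f x = 0) \<longrightarrow> norm (T x) \<le> \<epsilon> * norm x)"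
  shows "compact_operator T"
  unfolding compact_operator_def
proof (intro conjI T compact_closure_if_approximable)
  fix \<epsilon> :: real assume \<epsilon>: "0 < \<epsilon>"
  obtain F where F: "finite F" "\<And>x. \<forall>f\<in>F. cinner f x = 0 \<Longrightarrow> norm (T x) \<le> \<epsilon> * norm x"
    using small[OF \<epsilon>] by auto
  obtain K where K: "compact K"
    "\<And>x. norm x \<le> 1 \<Longrightarrow> \<exists>p\<in>K. norm (x - p) \<le> 1 \<and> (\<forall>f\<in>F. cinner f (x - p) = 0)"
    using finite_orthogonal_decomposition[OF F(1)] by auto
  have "\<exists>y\<in>T ` K. dist (T x) y \<le> \<epsilon>" if x: "norm x \<le> 1" for x
  proof -
    obtain p where p: "p \<in> K" "norm (x - p) \<le> 1" "\<forall>f\<in>F. cinner f (x - p) = 0"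
      using K(2)[OF x] by auto
    have "dist (T x) (T p) = norm (T (x - p))" by (simp add: dist_norm blinfun.diff_right)
    also have "\<dots> \<le> \<epsilon> * norm (x - p)" by (rule F(2)[OF p(3)])
    also have "\<dots> \<le> \<epsilon>" using p(2) \<epsilon> by (simp add: mult_left_le)
    finally show ?thesis using p(1) by blast
  qed
  moreover have "compact (T ` K)"
    by (intro compact_continuous_image K(1) continuous_intros)
  ultimately show "\<exists>K. compact K \<and> (\<forall>x\<in>T ` cball 0 1. \<exists>y\<in>K. dist x y \<le> \<epsilon>)"
    by (intro exI[of _ "T ` K"]) auto
qed

text \<open>
  As \<open>T\<close> is self-adjoint, orthogonality of \<open>T x\<close> to \<open>T (v i)\<close> is orthogonality of \<open>x\<close> to
  \<open>T (T (v i))\<close>; so extending the system by one vector imposes only finitely many orthogonality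
  conditions, under which \<open>big\<close> still provides a vector.
\<close>

lemma orthonormal_system_with_orthogonal_images:
  fixes T :: "'a::chilbert_space \<Rightarrow>\<^sub>L 'a" and m :: nat
  assumes T: "T \<in> bounded_operators" and sa: "self_adjoint T"
    and big: "\<And>F. finite F \<Longrightarrow> \<exists>x. (\<forall>f\<in>F. cinner f x = 0) \<and> \<delta> * norm x < norm (T x)"
  shows "\<exists>v. (\<forall>i<m. \<forall>j<m. cinner (v i) (v j) = (if i = j then 1 else 0)) \<and>
    (\<forall>i<m. \<forall>j<m. i \<noteq> j \<longrightarrow> cinner (T (v i)) (T (v j)) = 0) \<and> (\<forall>i<m. \<delta> \<le> norm (T (v i)))"
proof (induction m)
  case 0
  then show ?case by simp
next
  case (Suc m)
  then obtain v where v: "\<forall>i<m. \<forall>j<m. cinner (v i) (v j) = (if i = j then 1 else 0)"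
    "\<forall>i<m. \<forall>j<m. i \<noteq> j \<longrightarrow> cinner (T (v i)) (T (v j)) = 0"
    "\<forall>i<m. \<delta> \<le> norm (T (v i))"
    by (elim exE conjE)
  obtain x where x: "\<forall>f\<in>v ` {..<m} \<union> (\<lambda>i. T (T (v i))) ` {..<m}. cinner f x = 0"
    "\<delta> * norm x < norm (T x)"
    using big[of "v ` {..<m} \<union> (\<lambda>i. T (T (v i))) ` {..<m}"] by auto
  have x0: "x \<noteq> 0" using x(2) by auto
  define z where "z = complex_of_real (1 / norm x) *\<^sub>C x"
  have nz: "norm z = 1" using x0 by (simp add: z_def norm_scaleC norm_divide)
  then have zz: "cinner z z = 1" by (simp add: cinner_self)
  have Tz: "\<delta> \<le> norm (T z)"
    using x(2) x0 by (simp add: z_def bounded_operators_scaleC[OF T] norm_scaleC norm_divide field_simps)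
  have vz: "cinner (v i) z = 0" "cinner z (v i) = 0" if "i < m" for i
    using x(1) that cinner_eq_0_commute[of z "v i"] by (auto simp: z_def cinner_scaleC_right)
  have Tvz: "cinner (T (v i)) (T z) = 0" "cinner (T z) (T (v i)) = 0" if "i < m" for i
  proof -
    have "cinner (T (T (v i))) z = 0" using x(1) that by (auto simp: z_def cinner_scaleC_right)
    then show "cinner (T (v i)) (T z) = 0" using sa by (simp add: self_adjoint_def)
    then show "cinner (T z) (T (v i)) = 0" using cinner_eq_0_commute by blast
  qed
  show ?case
    by (rule exI[of _ "v(m := z)"]) (auto simp: less_Suc_eq v vz Tvz zz Tz)
qed

section \<open>Weak operator limits\<close>

text \<open>
  On the span of the \<open>N + 1\<close> vectors \<open>v i\<close> the limit \<open>T\<close> is bounded below by \<open>\<delta>\<close>, while each \<open>S d\<close>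
  is bounded by \<open>\<epsilon>\<close> on some non-zero vector \<open>x\<close> of this span. That \<open>x\<close> depends on \<open>d\<close> does no
  harm, since the sesquilinear forms of \<open>S d\<close> and \<open>T\<close> are close uniformly on the
  finite-dimensional spans of the \<open>v i\<close> and of their normalized images \<open>y i\<close>.
\<close>

lemma wot_limit_lower_bound:
  fixes T :: "'a::chilbert_space \<Rightarrow>\<^sub>L 'a"
  assumes F: "F \<noteq> bot" and lim: "wot_tendsto S T F"
    and S: "\<forall>\<^sub>F d in F. S d \<in> bounded_operators \<and> small_on_codim \<epsilon> N (S d)"
    and T: "T \<in> bounded_operators"
    and v: "\<And>i j. i \<le> N \<Longrightarrow> j \<le> N \<Longrightarrow> cinner (v i) (v j) = (if i = j then 1 else 0)"
    and Tv: "\<And>i j. i \<le> N \<Longrightarrow> j \<le> N \<Longrightarrow> i \<noteq> j \<Longrightarrow> cinner (T (v i)) (T (v j)) = 0"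
    and \<delta>: "0 < \<delta>" "\<And>i. i \<le> N \<Longrightarrow> \<delta> \<le> norm (T (v i))"
  shows "\<delta> \<le> \<epsilon>"
proof (rule field_le_epsilon)
  fix \<eta> :: real assume \<eta>: "0 < \<eta>"
  define r where "r i = norm (T (v i))" for i
  have r: "0 < r i" if "i \<le> N" for i
    unfolding r_def using \<delta>(1) \<delta>(2)[OF that] by (rule less_le_trans)
  define y where "y i = complex_of_real (1 / r i) *\<^sub>C T (v i)" for i
  have yT: "cinner (y i) (T (v j)) = (if i = j then complex_of_real (r i) else 0)" if "i \<le> N" "j \<le> N" for i j
    using r[OF that(1)] Tv[OF that]
    by (auto simp: y_def cinner_scaleC_left cinner_self r_def power2_eq_square)
  have yy: "cinner (y i) (y j) = (if i = j then 1 else 0)" if "i \<le> N" "j \<le> N" for i j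
    using yT[OF that] r[OF that(1)] by (auto simp: y_def[of j] cinner_scaleC_right)
  \<comment> \<open>The error sums up over \<open>(N + 1)\<^sup>2\<close> matrix entries.\<close>
  define \<theta> where "\<theta> = \<eta> / (real (Suc N))\<^sup>2"
  have \<theta>: "0 < \<theta>" using \<eta> by (simp add: \<theta>_def)
  have "\<forall>\<^sub>F d in F. \<forall>i\<in>{..N}. \<forall>j\<in>{..N}. dist (cinner (y i) (S d (v j))) (cinner (y i) (T (v j))) < \<theta>"
    using lim \<theta> by (intro eventually_ball_finite ballI) (auto simp: wot_tendsto_def tendsto_iff)
  with S have "\<forall>\<^sub>F d in F. (S d \<in> bounded_operators \<and> small_on_codim \<epsilon> N (S d)) \<and>
      (\<forall>i\<in>{..N}. \<forall>j\<in>{..N}. dist (cinner (y i) (S d (v j))) (cinner (y i) (T (v j))) < \<theta>)"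
    by (rule eventually_conj)
  then obtain d where d: "S d \<in> bounded_operators" "small_on_codim \<epsilon> N (S d)"
    "\<forall>i\<in>{..N}. \<forall>j\<in>{..N}. dist (cinner (y i) (S d (v j))) (cinner (y i) (T (v j))) < \<theta>"
    using eventually_happens'[OF F] by blast
  define E where "E i j = cinner (y i) (T (v j)) - cinner (y i) (S d (v j))" for i j
  have E: "cmod (E i j) \<le> \<theta>" if "i \<le> N" "j \<le> N" for i j
    using d(3) that by (force simp: E_def dist_norm norm_minus_commute)
  obtain G where G: "finite G" "card G \<le> N" "\<And>x. \<forall>g\<in>G. cinner g x = 0 \<Longrightarrow> norm (S d x) \<le> \<epsilon> * norm x"
    using d(2) unfolding small_on_codim_def by blast
  obtain c where c: "\<exists>j\<le>N. c j \<noteq> 0" "\<forall>g\<in>G. (\<Sum>j\<le>N. c j * cinner g (v j)) = 0"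
    using exists_nontrivial_solution[OF G(1,2), of "\<lambda>g j. cinner g (v j)"] by blast
  define x where "x = (\<Sum>j\<le>N. c j *\<^sub>C v j)"
  \<comment> \<open>Testing against the same combination of the \<open>y i\<close> makes the form of \<open>T\<close> a positive weighted sum.\<close>
  define w where "w = (\<Sum>i\<le>N. c i *\<^sub>C y i)"
  define s where "s = (\<Sum>j\<le>N. (cmod (c j))\<^sup>2)"
  have nx: "(norm x)\<^sup>2 = s" unfolding x_def s_def by (rule norm_sum_orthonormal_sq) (auto simp: v)
  have nw: "(norm w)\<^sup>2 = s" unfolding w_def s_def by (rule norm_sum_orthonormal_sq) (auto simp: yy)
  have nwx: "norm w = norm x" using nx nw by (metis norm_ge_zero power2_eq_iff_nonneg)
  have s: "0 < s"
  proof -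
    obtain j where j: "j \<le> N" "c j \<noteq> 0" using c(1) by auto
    have "(cmod (c j))\<^sup>2 \<le> s" unfolding s_def by (rule member_le_sum) (use j in auto)
    moreover have "0 < (cmod (c j))\<^sup>2" using j by simp
    ultimately show ?thesis by linarith
  qed
  have cx: "cmod (c i) \<le> norm x" if "i \<le> N" for i
  proof -
    have "(cmod (c i))\<^sup>2 \<le> (norm x)\<^sup>2" unfolding nx s_def by (rule member_le_sum) (use that in auto)
    then show ?thesis by (rule power2_le_imp_le) simp
  qed
  have form: "cinner w (B x) = (\<Sum>i\<le>N. \<Sum>j\<le>N. cnj (c i) * c j * cinner (y i) (B (v j)))"
    if "B \<in> bounded_operators" for B
    unfolding w_def x_def
    by (simp add: blinfun.sum_right bounded_operators_scaleC[OF that] cinner_sum_left cinner_sum_right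
        cinner_scaleC_left cinner_scaleC_right sum_distrib_left mult_ac)
      (rule sum.swap)
  have "cinner w (T x) = (\<Sum>i\<le>N. \<Sum>j\<le>N. if j = i then complex_of_real (r i * (cmod (c i))\<^sup>2) else 0)"
    unfolding form[OF T]
    by (intro sum.cong refl) (auto simp: yT complex_norm_square mult_ac simp del: of_real_power)
  then have wT: "cinner w (T x) = complex_of_real (\<Sum>i\<le>N. r i * (cmod (c i))\<^sup>2)" by simp
  have "\<delta> * s \<le> (\<Sum>i\<le>N. r i * (cmod (c i))\<^sup>2)"
    unfolding s_def sum_distrib_left by (intro sum_mono mult_right_mono) (auto simp: r_def \<delta>)
  also have "\<dots> \<le> cmod (cinner w (T x))" unfolding wT norm_of_real by simp
  also have "\<dots> \<le> cmod (cinner w (S d x)) + cmod (cinner w (T x) - cinner w (S d x))"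
    by (metis add.commute diff_add_cancel norm_triangle_ineq)
  also have "cmod (cinner w (S d x)) \<le> \<epsilon> * s"
  proof -
    have "\<forall>g\<in>G. cinner g x = 0"
      using c(2) by (simp add: x_def cinner_sum_right cinner_scaleC_right)
    then have "norm (S d x) \<le> \<epsilon> * norm x" by (rule G(3))
    then have "norm w * norm (S d x) \<le> norm x * (\<epsilon> * norm x)" unfolding nwx by (rule mult_left_mono) simp
    with cinner_cauchy_schwarz[of w "S d x"] show ?thesis
      unfolding nx[symmetric] by (simp add: power2_eq_square mult_ac)
  qed
  also have "cmod (cinner w (T x) - cinner w (S d x)) \<le> \<eta> * s"
  proof -
    have "cinner w (T x) - cinner w (S d x) = (\<Sum>i\<le>N. \<Sum>j\<le>N. cnj (c i) * c j * E i j)"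
      unfolding form[OF T] form[OF d(1)] E_def by (simp add: sum_subtractf right_diff_distrib)
    also have "cmod \<dots> \<le> (\<Sum>i\<le>N. \<Sum>j\<le>N. norm x * norm x * \<theta>)"
      by (intro sum_norm_le) (auto simp: norm_mult intro!: mult_mono cx E)
    also have "\<dots> = \<eta> * s" unfolding nx[symmetric] by (simp add: \<theta>_def power2_eq_square)
    finally show ?thesis .
  qed
  finally have "\<delta> * s \<le> (\<epsilon> + \<eta>) * s" by (simp add: distrib_right)
  then show "\<delta> \<le> \<epsilon> + \<eta>" using s by simp
qed

theorem compact_operator_wot_limit:
  fixes T :: "'a::chilbert_space \<Rightarrow>\<^sub>L 'a"
  assumes F: "F \<noteq> bot" and lim: "wot_tendsto S T F"
    and T: "T \<in> bounded_operators" "self_adjoint T"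
    and S: "\<And>\<epsilon>. 0 < \<epsilon> \<Longrightarrow> \<exists>N. \<forall>\<^sub>F d in F. S d \<in> bounded_operators \<and> small_on_codim \<epsilon> N (S d)"
  shows "compact_operator T"
proof (rule compact_operatorI[OF T(1)], rule ccontr)
  fix \<delta> :: real assume \<delta>: "0 < \<delta>"
    and "\<nexists>F. finite F \<and> (\<forall>x. (\<forall>f\<in>F. cinner f x = 0) \<longrightarrow> norm (T x) \<le> \<delta> * norm x)"
  then have big: "\<exists>x. (\<forall>f\<in>F. cinner f x = 0) \<and> \<delta> * norm x < norm (T x)" if "finite F" for F
    using that by (meson not_le)
  obtain N where N: "\<forall>\<^sub>F d in F. S d \<in> bounded_operators \<and> small_on_codim (\<delta> / 2) N (S d)"
    using S[of "\<delta> / 2"] \<delta> by auto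
  obtain v where v: "\<forall>i<Suc N. \<forall>j<Suc N. cinner (v i) (v j) = (if i = j then 1 else 0)"
    "\<forall>i<Suc N. \<forall>j<Suc N. i \<noteq> j \<longrightarrow> cinner (T (v i)) (T (v j)) = 0" "\<forall>i<Suc N. \<delta> \<le> norm (T (v i))"
    using orthonormal_system_with_orthogonal_images[OF T big, of "Suc N"] by blast
  have "\<delta> \<le> \<delta> / 2"
    by (rule wot_limit_lower_bound[OF F lim N T(1), of v]) (use v \<delta> in auto)
  then show False using \<delta> by simp
qed

section \<open>Completely positive maps\<close>

text \<open>
  Polarization with \<open>x + y\<close> and \<open>x + \<i> y\<close>.
\<close>

lemma self_adjointI_real_form:
  assumes B: "B \<in> bounded_operators" and re: "\<And>x. cinner x (B x) \<in> \<real>"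
  shows "self_adjoint B"
  unfolding self_adjoint_def
proof (intro allI)
  fix x y
  have im: "Im (cinner z (B z)) = 0" for z using re[of z] by (simp add: complex_is_Real_iff)
  have "Im (cinner x (B y)) + Im (cinner y (B x)) = 0"
    using im[of "x + y"] im[of x] im[of y] by (simp add: blinfun.add_right cinner_add_left cinner_add_right)
  moreover have "Re (cinner x (B y)) - Re (cinner y (B x)) = 0"
    using im[of "x + \<i> *\<^sub>C y"] im[of x] im[of y]
    by (simp add: blinfun.add_right cinner_add_left cinner_add_right bounded_operators_scaleC[OF B]
        cinner_scaleC_left cinner_scaleC_right)
  ultimately have "cinner x (B y) = cnj (cinner y (B x))" by (simp add: complex_eq_iff)
  then show "cinner (B x) y = cinner x (B y)" by (metis cinner_commute)
qed

lemma self_adjoint_real_form: "self_adjoint B \<Longrightarrow> cinner x (B x) \<in> \<real>"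
  unfolding self_adjoint_def by (metis Reals_cnj_iff cinner_commute)

text \<open>
  Positivity suffices, since \<open>A\<close> is the difference of the positive operators \<open>A + \<parallel>A\<parallel> I\<close> and
  \<open>\<parallel>A\<parallel> I\<close>, whose images have real quadratic forms.
\<close>

lemma completely_positive_self_adjoint:
  fixes \<Phi> :: "('a::chilbert_space \<Rightarrow>\<^sub>L 'a) \<Rightarrow> ('a \<Rightarrow>\<^sub>L 'a)"
  assumes cp: "completely_positive \<Phi>" and A: "A \<in> bounded_operators" "self_adjoint A"
  shows "self_adjoint (\<Phi> A)"
proof -
  have pos: "cinner x (\<Phi> B x) \<in> \<real>" if B: "B \<in> bounded_operators" "\<And>x. cinner x (B x) \<in> \<real>\<^sub>\<ge>\<^sub>0" for B x
  proof -
    have "positive_op_matrix 1 (\<lambda>i j. B)" using B(2) by (simp add: positive_op_matrix_def)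
    with cp B(1) have "positive_op_matrix 1 (\<lambda>i j. \<Phi> B)"
      unfolding completely_positive_def by (elim conjE allE[of _ 1] allE[of _ "\<lambda>i j. B"]) simp
    then have "cinner x (\<Phi> B x) \<in> \<real>\<^sub>\<ge>\<^sub>0" unfolding positive_op_matrix_def by auto
    then show ?thesis by (rule nonneg_Reals_subset_Reals[THEN subsetD])
  qed
  let ?c = "complex_of_real (norm A)"
  let ?I = "scaleC_op ?c id_blinfun :: 'a \<Rightarrow>\<^sub>L 'a"
  have I: "id_blinfun \<in> (bounded_operators :: ('a \<Rightarrow>\<^sub>L 'a) set)" by (simp add: bounded_operators_def)
  have I': "?I \<in> bounded_operators"
    by (simp add: bounded_operators_def scaleC_op.rep_eq scaleC_scaleC mult.commute)
  have AI: "A + ?I \<in> bounded_operators"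
    using A(1) I' by (simp add: bounded_operators_def blinfun.add_left scaleC_add_right)
  have form: "cinner x (?I x) = complex_of_real (norm A * (norm x)\<^sup>2)" for x
    by (simp add: scaleC_op.rep_eq cinner_scaleC_right cinner_self)
  have "cinner x ((A + ?I) x) \<in> \<real>\<^sub>\<ge>\<^sub>0" for x
  proof -
    have "\<bar>Re (cinner x (A x))\<bar> \<le> norm x * (norm A * norm x)"
      by (meson abs_Re_le_cmod cinner_cauchy_schwarz mult_left_mono norm_blinfun norm_ge_zero order_trans)
    then have "0 \<le> Re (cinner x (A x)) + norm A * (norm x)\<^sup>2"
      by (simp add: power2_eq_square mult_ac abs_le_iff)
    then show ?thesis
      using self_adjoint_real_form[OF A(2), of x] form[of x]
      by (simp add: blinfun.add_left cinner_add_right complex_nonneg_Reals_iff complex_is_Real_iff)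
  qed
  note 1 = pos[OF AI this]
  have 2: "cinner x (\<Phi> ?I x) \<in> \<real>" for x
    by (rule pos[OF I']) (simp add: form)
  have "\<Phi> (A + ?I) = \<Phi> A + \<Phi> ?I" using cp A(1) I' by (simp add: completely_positive_def)
  then have "cinner x (\<Phi> A x) = cinner x (\<Phi> (A + ?I) x) - cinner x (\<Phi> ?I x)" for x
    by (simp add: blinfun.add_left cinner_add_right)
  then have "cinner x (\<Phi> A x) \<in> \<real>" for x using 1 2 by (simp add: Reals_diff)
  moreover have "\<Phi> A \<in> bounded_operators" using cp A(1) by (simp add: completely_positive_def)
  ultimately show ?thesis by (intro self_adjointI_real_form)
qed

section \<open>The limit of the preconditioners\<close>

theorem theorem4p2:
  fixes P :: "nat \<Rightarrow> 'a::chilbert_space \<Rightarrow>\<^sub>L 'a"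
    and e :: "nat \<Rightarrow> nat \<Rightarrow> 'a"
    and U :: "nat \<Rightarrow> complex mat"
    and D :: "'i set" and R :: "'i \<Rightarrow> 'i \<Rightarrow> bool" and h :: "'i \<Rightarrow> nat"
    and \<Phi> :: "('a \<Rightarrow>\<^sub>L 'a) \<Rightarrow> ('a \<Rightarrow>\<^sub>L 'a)"
    and A :: "'a \<Rightarrow>\<^sub>L 'a"
  assumes "separable_space (euclidean :: 'a topology)"
    and "\<And>n. orthogonal_projection (P n)"
    and "\<And>n. complex_vector.dim (range (blinfun_apply (P n))) = n"
    and "\<And>x. (\<lambda>n. P n x) \<longlonglongrightarrow> x"
    and "\<And>n. orthonormal_basis_of (e n) n (range (blinfun_apply (P n)))"
    and "\<And>n. unitary_matrix n (U n)"
    and "bw_subnet_limit D R h (preconditioner_map P e U) \<Phi>"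
    and "A \<in> bounded_operators"
    and "self_adjoint A"
    and "converges_in_strong_cluster
           (\<lambda>n. nearest_diagonalized n (U n) (compression P e n A))
           (\<lambda>n. compression P e n A)"
  shows "compact_operator (A - \<Phi> A)"
proof -
  define S where "S n = (P n o\<^sub>L A o\<^sub>L P n) - preconditioner_map P e U n A" for n
  have dir: "directed_set D R" and h: "filterlim h sequentially (net_filter D R)"
    and bw: "bw_tendsto (\<lambda>d. preconditioner_map P e U (h d)) \<Phi> (net_filter D R)"
    using assms(7) by (auto simp: bw_subnet_limit_def)
  have cp: "completely_positive \<Phi>" using bw by (simp add: bw_tendsto_def cp_contractions_def)
  have lim: "wot_tendsto (\<lambda>d. preconditioner_map P e U (h d) A) (\<Phi> A) (net_filter D R)"
    using bw assms(8) by (simp add: bw_tendsto_def)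
  have \<Phi>A: "\<Phi> A \<in> bounded_operators" "self_adjoint (\<Phi> A)"
    using cp assms(8) completely_positive_self_adjoint[OF cp assms(8,9)]
    by (auto simp: completely_positive_def)
  have comp: "op_of_matrix (e n) n (compression P e n A) = P n o\<^sub>L A o\<^sub>L P n" for n
    by (intro op_of_compression assms)
  have S_op: "S n \<in> bounded_operators" for n
    unfolding S_def preconditioner_map_def
  proof (intro diff_bounded_operators op_of_matrix_bounded_operator)
    show "P n o\<^sub>L A o\<^sub>L P n \<in> bounded_operators"
      using assms(2)[of n] assms(8) by (simp add: orthogonal_projection_def bounded_operators_def)
  qed
  have S_wot: "wot_tendsto (\<lambda>d. S (h d)) (A - \<Phi> A) (net_filter D R)"
    unfolding wot_tendsto_def
  proof (intro allI)
    fix x y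
    have "((\<lambda>n. cinner x ((P n o\<^sub>L A o\<^sub>L P n) y)) \<longlongrightarrow> cinner x (A y)) sequentially"
      using compression_wot_tendsto[of P A, OF assms(2,4)] by (simp only: wot_tendsto_def)
    from tendsto_diff[OF filterlim_compose[OF this h]] lim
    show "((\<lambda>d. cinner x (S (h d) y)) \<longlongrightarrow> cinner x ((A - \<Phi> A) y)) (net_filter D R)"
      by (simp only: S_def minus_blinfun.rep_eq cinner_diff_right wot_tendsto_def)
  qed
  have S_small: "\<exists>N. \<forall>\<^sub>F d in net_filter D R. S (h d) \<in> bounded_operators \<and> small_on_codim \<epsilon> N (S (h d))"
    if \<epsilon>: "0 < \<epsilon>" for \<epsilon>
  proof -
    let ?Y = "\<lambda>n. nearest_diagonalized n (U n) (compression P e n A)"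
    let ?C = "\<lambda>n. compression P e n A"
    obtain N1 N2 where N: "\<And>n. n > N2 \<Longrightarrow> size {#s \<in># singular_values (?Y n - ?C n). s \<notin> {0..<\<epsilon>}#} \<le> N1"
      using assms(10) \<epsilon> unfolding converges_in_strong_cluster_def by blast
    have "small_on_codim \<epsilon> N1 (S n)" if n: "n > N2" for n
    proof -
      have C: "?C n \<in> carrier_mat n n" by (simp add: compression_def matrix_of_op_def)
      obtain W where "finite W" "card W \<le> N1" "\<And>x. (\<forall>w\<in>W. (\<Sum>k<n. w k * x k) = 0) \<Longrightarrow>
        (\<Sum>i<n. (cmod (\<Sum>j<n. (?Y n - ?C n) $$ (i, j) * x j))\<^sup>2) \<le> \<epsilon>\<^sup>2 * (\<Sum>j<n. (cmod (x j))\<^sup>2)"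
        using quadratic_bound_off_large_singular_values[OF minus_carrier_mat[OF C, of "?Y n"] \<epsilon> N[OF n]]
        by blast
      then have "small_on_codim \<epsilon> N1 (op_of_matrix (e n) n (?Y n - ?C n))"
        by (rule small_on_codim_op_of_matrix[OF assms(5) less_imp_le[OF \<epsilon>]])
      moreover have "norm (S n x) = norm (op_of_matrix (e n) n (?Y n - ?C n) x)" for x
        unfolding op_of_matrix_diff[OF C] comp S_def preconditioner_map_def
          minus_blinfun.rep_eq by (rule norm_minus_commute)
      ultimately show ?thesis by (simp only: small_on_codim_def)
    qed
    then have "\<forall>\<^sub>F n in sequentially. S n \<in> bounded_operators \<and> small_on_codim \<epsilon> N1 (S n)"
      unfolding eventually_sequentially using S_op by (intro exI[of _ "Suc N2"]) (auto simp: Suc_le_eq)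
    from eventually_compose_filterlim[OF this h] show ?thesis by blast
  qed
  have "A - \<Phi> A \<in> bounded_operators" by (rule diff_bounded_operators[OF assms(8) \<Phi>A(1)])
  moreover have "self_adjoint (A - \<Phi> A)"
    using assms(9) \<Phi>A(2) by (simp add: self_adjoint_def minus_blinfun.rep_eq cinner_diff_left cinner_diff_right)
  ultimately show ?thesis
    by (rule compact_operator_wot_limit[OF net_filter_neq_bot[OF dir] S_wot _ _ S_small])
qed

end
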